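(* Let $n\ge 1$, $A\ge 0$ and $0<\lambda\le\Lambda$. There are $\alpha>0$ and $C>0$ (depending only on $A$, $n$, $\lambda$, $\Lambda$) such that the following holds. Let $t>0$ and let $u:\mathbb{R}^n\times[0,t]\to\mathbb{R}$ be a bounded continuous function which satisfies, in the viscosity sense in $\mathbb{R}^n\times[0,t]$, the two inequalities $$u_t - A|\nabla u| - M^+u\le 0,\qquad u_t + A|\nabla u| - M^-u\ge 0 .$$ Then $u$ is $C^\alpha$ for positive times, with the estimate $$|u(x,t)-u(y,s)|\le C\,\|u(\cdot,0)\|_{L^\infty}\,\frac{|x-y|^\alpha+|t-s|^\alpha}{t^\alpha}\qquad\text{for every }x,y\in\mathbb{R}^n\text{ and }0\le s\le t.$$ Equivalently, $$\|u\|_{C^\alpha(\mathbb{R}^n\times[t/2,t])}\le\frac{C}{t^\alpha}\,\|u(\cdot,0)\|_{L^\infty}$$ (with a possibly different constant $C$ of the same type).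
   Context: Extremal operators: with $\delta u(x,y):=u(x+y)+u(x-y)-2u(x)$ and $z^+=\max(z,0)$, $z^-=\max(-z,0)$, $$M^+u(x)=\frac12\int_{\mathbb{R}^n}\frac{\Lambda\,\delta u(x,y)^+-\lambda\,\delta u(x,y)^-}{|y|^{n+1}}\,dy,\qquad M^-u(x)=\frac12\int_{\mathbb{R}^n}\frac{\lambda\,\delta u(x,y)^+-\Lambda\,\delta u(x,y)^-}{|y|^{n+1}}\,dy,$$ acting on the space variable at fixed time. Viscosity sense: an upper (resp. lower) semicontinuous function $u$ satisfies $u_t-A|\nabla u|-M^+u\le 0$ (resp. $u_t+A|\nabla u|-M^-u\ge0$) in the viscosity sense if, whenever a $C^2$ function $\varphi$ touches $u$ from above (resp. below) at a point $(x,t_0)$ with $t_0>0$, i.e. for some $r>0$, $\varphi(x,t_0)=u(x,t_0)$ and $\varphi(y,s)\ge u(y,s)$ (resp. $\le$) for all $(y,s)$ with $|x-y|<r$, $t_0-r<s\le t_0$, then the function $v$ equal to $\varphi$ in $U:=B_r(x)\times(t_0-r,t_0+r)$ and to $u$ outside $U$ satisfies $v_t-A|\nabla v|-M^+v\le0$ (resp. $v_t+A|\nabla v|-M^-v\ge0$) at $(x,t_0)$. Here $\|u\|_{C^\alpha(\mathbb{R}^n\times[t/2,t])}$ denotes the Hölder seminorm $\sup\frac{|u(x,\tau)-u(y,s)|}{|x-y|^\alpha+|\tau-s|^\alpha}$ over distinct points $(x,\tau),(y,s)\in\mathbb{R}^n\times[t/2,t]$. *)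

theory Defs
  imports "HOL-Probability.Essential_Supremum"
begin

text \<open>Space-time functions have type \<open>(real^'n) \<times> real \<Rightarrow> real\<close>; the space dimension is
  \<open>CARD('n)\<close>, which is at least 1.\<close>

subsection \<open>Extremal operators\<close>

definition second_diff :: "(real^'n \<Rightarrow> real) \<Rightarrow> real^'n \<Rightarrow> real^'n \<Rightarrow> real" where
  "second_diff w x y = w (x + y) + w (x - y) - 2 * w x"

definition pos_part :: "real \<Rightarrow> real" where "pos_part z = max z 0"

definition neg_part :: "real \<Rightarrow> real" where "neg_part z = max (- z) 0"

text \<open>The integrand is absolutely integrable if \<open>w\<close> is bounded, measurable and \<open>C\<^sup>2\<close> near \<open>x\<close>;
  this covers every use below when \<open>u\<close> is bounded and continuous.\<close>

definition Mplus :: "real \<Rightarrow> real \<Rightarrow> (real^'n \<Rightarrow> real) \<Rightarrow> real^'n \<Rightarrow> real" where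
  "Mplus lam Lam w x = 1 / 2 * (LINT y|lborel.
     (Lam * pos_part (second_diff w x y) - lam * neg_part (second_diff w x y))
       / norm y ^ (CARD('n) + 1))"

definition Mminus :: "real \<Rightarrow> real \<Rightarrow> (real^'n \<Rightarrow> real) \<Rightarrow> real^'n \<Rightarrow> real" where
  "Mminus lam Lam w x = 1 / 2 * (LINT y|lborel.
     (lam * pos_part (second_diff w x y) - Lam * neg_part (second_diff w x y))
       / norm y ^ (CARD('n) + 1))"

subsection \<open>Viscosity inequalities\<close>

definition grad :: "(real^'n \<Rightarrow> real) \<Rightarrow> real^'n \<Rightarrow> real^'n" where
  "grad w x = (THE D. GDERIV w x :> D)"

definition C2 :: "('a::real_normed_vector \<Rightarrow> real) \<Rightarrow> bool" where
  "C2 f \<longleftrightarrow> (\<exists>(f' :: 'a \<Rightarrow> 'a \<Rightarrow>\<^sub>L real) (f'' :: 'a \<Rightarrow> 'a \<Rightarrow>\<^sub>L 'a \<Rightarrow>\<^sub>L real).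
     (\<forall>p. (f has_derivative blinfun_apply (f' p)) (at p)) \<and>
     (\<forall>p. (f' has_derivative blinfun_apply (f'' p)) (at p)) \<and>
     continuous_on UNIV f'')"

definition upper_semicontinuous_on :: "'a::topological_space set \<Rightarrow> ('a \<Rightarrow> real) \<Rightarrow> bool" where
  "upper_semicontinuous_on S f \<longleftrightarrow> (\<forall>c. openin (top_of_set S) {p \<in> S. f p < c})"

definition lower_semicontinuous_on :: "'a::topological_space set \<Rightarrow> ('a \<Rightarrow> real) \<Rightarrow> bool" where
  "lower_semicontinuous_on S f \<longleftrightarrow> (\<forall>c. openin (top_of_set S) {p \<in> S. f p > c})"

text \<open>Contact is tested only at past times \<open>s \<le> t0\<close>. The guard \<open>0 \<le> s\<close> keeps \<open>(y, s)\<close> in the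
  domain of \<open>u\<close> when \<open>r > t0\<close>.\<close>

definition touches_above ::
  "((real^'n) \<times> real \<Rightarrow> real) \<Rightarrow> ((real^'n) \<times> real \<Rightarrow> real) \<Rightarrow> real^'n \<Rightarrow> real \<Rightarrow> real \<Rightarrow> bool" where
  "touches_above \<phi> u x t0 r \<longleftrightarrow> r > 0 \<and> \<phi> (x, t0) = u (x, t0) \<and>
     (\<forall>y s. norm (x - y) < r \<and> t0 - r < s \<and> s \<le> t0 \<and> 0 \<le> s \<longrightarrow> \<phi> (y, s) \<ge> u (y, s))"

definition touches_below ::
  "((real^'n) \<times> real \<Rightarrow> real) \<Rightarrow> ((real^'n) \<times> real \<Rightarrow> real) \<Rightarrow> real^'n \<Rightarrow> real \<Rightarrow> real \<Rightarrow> bool" where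
  "touches_below \<phi> u x t0 r \<longleftrightarrow> r > 0 \<and> \<phi> (x, t0) = u (x, t0) \<and>
     (\<forall>y s. norm (x - y) < r \<and> t0 - r < s \<and> s \<le> t0 \<and> 0 \<le> s \<longrightarrow> \<phi> (y, s) \<le> u (y, s))"

definition glue ::
  "((real^'n) \<times> real \<Rightarrow> real) \<Rightarrow> ((real^'n) \<times> real \<Rightarrow> real) \<Rightarrow> real^'n \<Rightarrow> real \<Rightarrow> real
     \<Rightarrow> (real^'n) \<times> real \<Rightarrow> real" where
  "glue \<phi> u x t0 r p = (if p \<in> ball x r \<times> {t0 - r<..<t0 + r} then \<phi> p else u p)"

text \<open>\<open>u_t - A |\<nabla>u| - M\<^sup>+u \<le> 0\<close> and \<open>u_t + A |\<nabla>u| - M\<^sup>-u \<ge> 0\<close> in the viscosity sense in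
  \<open>\<real>\<^sup>n \<times> [0, T]\<close>. Only the values of \<open>u\<close> on this set matter: the time derivative and the gradient
  of the glued function at \<open>(x, t0)\<close> are those of \<open>\<phi>\<close>, and the integral operator sees only the
  time slice \<open>t0\<close>.\<close>

definition viscosity_sub ::
  "real \<Rightarrow> real \<Rightarrow> real \<Rightarrow> real \<Rightarrow> ((real^'n) \<times> real \<Rightarrow> real) \<Rightarrow> bool" where
  "viscosity_sub A lam Lam T u \<longleftrightarrow>
     upper_semicontinuous_on (UNIV \<times> {0..T}) u \<and>
     (\<forall>\<phi> x t0 r. C2 \<phi> \<and> 0 < t0 \<and> t0 \<le> T \<and> touches_above \<phi> u x t0 r \<longrightarrow>
       (let v = glue \<phi> u x t0 r in
          deriv (\<lambda>s. v (x, s)) t0 - A * norm (grad (\<lambda>y. v (y, t0)) x)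
            - Mplus lam Lam (\<lambda>y. v (y, t0)) x \<le> 0))"

definition viscosity_super ::
  "real \<Rightarrow> real \<Rightarrow> real \<Rightarrow> real \<Rightarrow> ((real^'n) \<times> real \<Rightarrow> real) \<Rightarrow> bool" where
  "viscosity_super A lam Lam T u \<longleftrightarrow>
     lower_semicontinuous_on (UNIV \<times> {0..T}) u \<and>
     (\<forall>\<phi> x t0 r. C2 \<phi> \<and> 0 < t0 \<and> t0 \<le> T \<and> touches_below \<phi> u x t0 r \<longrightarrow>
       (let v = glue \<phi> u x t0 r in
          deriv (\<lambda>s. v (x, s)) t0 + A * norm (grad (\<lambda>y. v (y, t0)) x)
            - Mminus lam Lam (\<lambda>y. v (y, t0)) x \<ge> 0))"

subsection \<open>Norms\<close>

definition Linf_norm :: "(real^'n \<Rightarrow> real) \<Rightarrow> real" where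
  "Linf_norm f = real_of_ereal (esssup lborel (\<lambda>x. ereal \<bar>f x\<bar>))"

text \<open>Extended-real valued, so that an infinite supremum is not conflated with a finite one.\<close>

definition holder_seminorm ::
  "real \<Rightarrow> ((real^'n) \<times> real) set \<Rightarrow> ((real^'n) \<times> real \<Rightarrow> real) \<Rightarrow> ereal" where
  "holder_seminorm \<alpha> S u =
     (SUP ((x, \<tau>), (y, s)) \<in> {(p, q). p \<in> S \<and> q \<in> S \<and> p \<noteq> q}.
        ereal (\<bar>u (x, \<tau>) - u (y, s)\<bar> / (norm (x - y) powr \<alpha> + \<bar>\<tau> - s\<bar> powr \<alpha>)))"

end

theory Submission
  imports Defs
begin

text \<open>The proof is of Ishii--Lions type. Assume that \<open>u(x,T) - u(y,T) > L|x - y|^\<alpha>\<close> for some points and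
  maximise \<open>u(x,t) - u(y,s) - L|x - y|^\<alpha>\<close> minus penalisations of \<open>|x|\<close>, of \<open>t - s\<close> and of \<open>T - t\<close>.
  Let \<open>\<rho> = |x - y|\<close> at the maximum. As \<open>\<alpha> \<rightarrow> 0\<close>, all terms of the two viscosity inequalities that come from
  the test function, that is the drift and the positive parts of second differences, are
  \<open>O(\<alpha>) L \<rho>^(\<alpha> - 1)\<close>. On the other hand both jump kernels have a common part of mass of order \<open>1/\<rho>\<close> around
  the midpoint of \<open>x\<close> and \<open>y\<close>; there the values of \<open>u\<close> cancel in the difference of the two inequalities,
  which leaves a gain \<open>-c L \<rho>^(\<alpha> - 1)\<close> with \<open>c\<close> independent of \<open>\<alpha>\<close>. For small \<open>\<alpha>\<close> this is a
  contradiction once \<open>L\<close> is a large multiple of \<open>\<parallel>u\<parallel> / T^\<alpha>\<close>.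

  Regularity in time and the bound of \<open>u\<close> by its initial values follow by comparison with the barriers
  \<open>a + L (|x - x0|^2 + \<eta>^2)^(\<alpha>/2) + K (t - s)\<close>.\<close>

subsection \<open>Integrability of the majorant\<close>

text \<open>A common majorant for all second differences that occur: quadratic at the origin, and with
  square root growth at infinity, so that it is integrable against \<open>|y|\<close> to the power \<open>-(n+1)\<close>.\<close>

definition qgrowth :: "real \<Rightarrow> real" where "qgrowth s = min (s\<^sup>2) (sqrt s)"

definition qgrowth_kernel :: "real^'n \<Rightarrow> real" where
  "qgrowth_kernel y = qgrowth (norm y) / norm y ^ (CARD('n) + 1)"

lemma qgrowth_nonneg [simp]: "0 \<le> s \<Longrightarrow> 0 \<le> qgrowth s"
  by (simp add: qgrowth_def)

lemma qgrowth_pos: "0 < s \<Longrightarrow> 0 < qgrowth s"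
  by (simp add: qgrowth_def)

lemma qgrowth_mono: "0 \<le> s \<Longrightarrow> s \<le> t \<Longrightarrow> qgrowth s \<le> qgrowth t"
  unfolding qgrowth_def by (intro min.mono power_mono real_sqrt_le_mono) auto

lemma qgrowth_eq_square: "0 \<le> s \<Longrightarrow> s \<le> 1 \<Longrightarrow> qgrowth s = s\<^sup>2"
proof -
  assume s: "0 \<le> s" "s \<le> 1"
  have "s\<^sup>2 \<le> s" using s by (simp add: power2_eq_square mult_left_le)
  also have "s \<le> sqrt s" using s by (intro real_le_rsqrt) (simp add: power2_eq_square mult_left_le)
  finally show ?thesis by (simp add: qgrowth_def)
qed

lemma qgrowth_kernel_nonneg [simp]: "0 \<le> qgrowth_kernel y"
  by (simp add: qgrowth_kernel_def)

lemma borel_measurable_qgrowth_kernel [measurable]: "qgrowth_kernel \<in> borel_measurable borel"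
  unfolding qgrowth_kernel_def[abs_def] qgrowth_def by measurable

text \<open>A ball of radius R has volume proportional to R^n, so the k-th summand integrates to a
  constant times \<open>qgrowth (R k) / R k\<close>. Full balls stand in for dyadic shells; the
  factor 2^(n+1) pays for |y| being as small as R/2 on a shell.\<close>

lemma nn_integral_shells_finite:
  fixes R :: "nat \<Rightarrow> real"
  assumes R: "\<And>k. 0 < R k" and sm: "summable (\<lambda>k. qgrowth (R k) / R k)"
  shows "(\<integral>\<^sup>+ y. (\<Sum>k. ennreal (2 ^ (CARD('n) + 1) * qgrowth (R k) / R k ^ (CARD('n) + 1))
           * indicator (ball 0 (R k)) (y :: real^'n)) \<partial>lborel) < \<infinity>"
proof -
  let ?n = "CARD('n)"
  let ?c = "2 ^ (?n + 1) * unit_ball_vol (real ?n)"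
  have eq: "(\<integral>\<^sup>+ y. ennreal (2 ^ (?n + 1) * qgrowth (R k) / R k ^ (?n + 1)) * indicator (ball 0 (R k)) (y :: real^'n) \<partial>lborel)
      = ennreal (?c * (qgrowth (R k) / R k))" for k
  proof -
    have "(\<integral>\<^sup>+ y. ennreal (2 ^ (?n + 1) * qgrowth (R k) / R k ^ (?n + 1)) * indicator (ball 0 (R k)) (y :: real^'n) \<partial>lborel)
       = ennreal (2 ^ (?n + 1) * qgrowth (R k) / R k ^ (?n + 1)) * ennreal (unit_ball_vol (real ?n) * R k ^ ?n)"
      using R[of k] by (subst nn_integral_cmult_indicator) (auto simp: emeasure_ball)
    also have "\<dots> = ennreal (?c * (qgrowth (R k) / R k))"
      using R[of k] by (subst ennreal_mult[symmetric]) (auto simp: less_imp_le)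
    finally show ?thesis .
  qed
  have sm': "summable (\<lambda>k. ?c * (qgrowth (R k) / R k))" using sm by (rule summable_mult)
  have nn: "0 \<le> ?c * (qgrowth (R k) / R k)" for k using R[of k] by (auto simp: less_imp_le)
  show ?thesis
  proof (subst nn_integral_suminf)
    show "(\<lambda>y. ennreal (2 ^ (?n + 1) * qgrowth (R k) / R k ^ (?n + 1)) * indicator (ball 0 (R k)) (y :: real^'n))
        \<in> borel_measurable lborel" for k
      by (intro borel_measurable_times_ennreal borel_measurable_const borel_measurable_indicator) auto
    show "(\<Sum>k. \<integral>\<^sup>+ y. ennreal (2 ^ (?n + 1) * qgrowth (R k) / R k ^ (?n + 1))
        * indicator (ball 0 (R k)) (y :: real^'n) \<partial>lborel) < \<infinity>"
      unfolding eq using suminf_ennreal2[OF nn sm'] by simp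
  qed
qed

lemma qgrowth_kernel_le_shell:
  fixes y :: "real^'n"
  assumes "0 < R" "R / 2 \<le> norm y" "norm y < R"
  shows "qgrowth_kernel y \<le> 2 ^ (CARD('n) + 1) * qgrowth R / R ^ (CARD('n) + 1)"
proof -
  have "qgrowth_kernel y \<le> qgrowth R / (R / 2) ^ (CARD('n) + 1)"
    unfolding qgrowth_kernel_def using assms by (intro frac_le qgrowth_mono power_mono) auto
  also have "\<dots> = 2 ^ (CARD('n) + 1) * qgrowth R / R ^ (CARD('n) + 1)"
    by (simp add: power_divide)
  finally show ?thesis .
qed

lemma exists_dyadic_ge_1:
  assumes "1 \<le> (s::real)"
  shows "\<exists>k. 2 ^ Suc k / 2 \<le> s \<and> s < 2 ^ Suc k"
proof -
  define P where "P k \<longleftrightarrow> s < 2 ^ k" for k :: nat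
  obtain k0 where "P k0" using real_arch_pow[of 2 s] by (auto simp: P_def)
  define m where "m = (LEAST k. P k)"
  have m: "P m" unfolding m_def using \<open>P k0\<close> by (rule LeastI)
  have "m \<noteq> 0" using m assms by (auto simp: P_def intro: ccontr)
  then obtain k where k: "m = Suc k" by (cases m) auto
  have "\<not> P k" using not_less_Least[of k P] k unfolding m_def by auto
  then show ?thesis using m k by (intro exI[of _ k]) (auto simp: P_def)
qed

lemma exists_dyadic_less_1:
  assumes "0 < s" "(s::real) < 1"
  shows "\<exists>k. (1 / 2) ^ k / 2 \<le> s \<and> s < (1 / 2) ^ k"
proof -
  define P where "P k \<longleftrightarrow> (1 / 2) ^ k \<le> s" for k :: nat
  obtain k0 where "(1 / 2) ^ k0 < s" using real_arch_pow_inv[of s "1/2"] assms by auto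
  then have "P k0" by (simp add: P_def)
  define m where "m = (LEAST k. P k)"
  have m: "P m" unfolding m_def using \<open>P k0\<close> by (rule LeastI)
  have "m \<noteq> 0" using m assms by (auto simp: P_def intro: ccontr)
  then obtain k where k: "m = Suc k" by (cases m) auto
  have "\<not> P k" using not_less_Least[of k P] k unfolding m_def by auto
  then show ?thesis using m k by (intro exI[of _ k]) (auto simp: P_def)
qed

text \<open>Dyadic shells: \<open>qgrowth R / R\<close> equals R in the unit ball and is at most
  R^(-1/2) outside, so the shell masses are dominated by geometric series on both sides.\<close>

lemma integrable_qgrowth_kernel: "integrable lborel (qgrowth_kernel :: real^'n \<Rightarrow> real)"
proof -
  let ?n = "CARD('n)"
  define F where "F R y = ennreal (2 ^ (?n + 1) * qgrowth R / R ^ (?n + 1)) * indicator (ball 0 R) y"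
    for R :: real and y :: "real^'n"
  have small: "(\<integral>\<^sup>+ y. (\<Sum>k. F ((1/2) ^ k) y) \<partial>lborel) < \<infinity>"
    unfolding F_def
  proof (rule nn_integral_shells_finite)
    have "qgrowth ((1/2) ^ k) / (1/2) ^ k = (1/2) ^ k" for k
      by (subst qgrowth_eq_square) (auto simp: power2_eq_square power_le_one)
    then show "summable (\<lambda>k. qgrowth ((1/2::real) ^ k) / (1/2) ^ k)"
      by (simp only:) (rule summable_geometric, simp)
  qed auto
  \<comment> \<open>The radii start at 2, so the first outer shell is 1 <= |y| < 2 and adjoins the
    inner shells, whose largest radius is 1.\<close>
  have large: "(\<integral>\<^sup>+ y. (\<Sum>k. F (2 ^ Suc k) y) \<partial>lborel) < \<infinity>"
    unfolding F_def
  proof (rule nn_integral_shells_finite)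
    have b: "norm (qgrowth (2 ^ Suc k) / 2 ^ Suc k) \<le> (1 / sqrt 2) ^ Suc k" for k
    proof -
      have "qgrowth (2 ^ Suc k) / 2 ^ Suc k \<le> sqrt (2 ^ Suc k) / 2 ^ Suc k"
        unfolding qgrowth_def by (intro divide_right_mono) auto
      also have "\<dots> = 1 / sqrt (2 ^ Suc k)"
        using real_divide_square_eq[of "sqrt (2 ^ Suc k)" 1] by simp
      also have "\<dots> = (1 / sqrt 2) ^ Suc k" by (simp only: real_sqrt_power power_one_over)
      finally show ?thesis by (simp add: less_imp_le)
    qed
    have "summable (\<lambda>k. (1 / sqrt 2) ^ Suc k)"
      by (subst summable_Suc_iff) (rule summable_geometric, simp)
    then show "summable (\<lambda>k. qgrowth ((2::real) ^ Suc k) / 2 ^ Suc k)"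
      by (rule summable_comparison_test'[where N = 0]) (rule b)
  qed simp
  have le: "ennreal (qgrowth_kernel y) \<le> (\<Sum>k. F ((1/2) ^ k) y) + (\<Sum>k. F (2 ^ Suc k) y)" for y
  proof -
    have F: "ennreal (qgrowth_kernel y) \<le> F R y" if "0 < R" "R / 2 \<le> norm y" "norm y < R" for R
      using qgrowth_kernel_le_shell[OF that] that by (auto simp: F_def intro!: ennreal_leI)
    have tm: "f k \<le> suminf f" for f :: "nat \<Rightarrow> ennreal" and k
      using sum_le_suminf[of f "{k}"] by (simp add: summableI)
    \<comment> \<open>The origin lies in no shell; there the kernel is 0/0 = 0.\<close>
    consider "y = 0" | "0 < norm y" "norm y < 1" | "1 \<le> norm y" by fastforce
    then show ?thesis
    proof cases
      case 1 then show ?thesis by (simp add: qgrowth_kernel_def)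
    next
      case 2
      from exists_dyadic_less_1[OF this] obtain k
        where "(1 / 2) ^ k / 2 \<le> norm y" "norm y < (1 / 2) ^ k" by auto
      then have "ennreal (qgrowth_kernel y) \<le> F ((1/2) ^ k) y" by (intro F) auto
      also have "\<dots> \<le> (\<Sum>k. F ((1/2) ^ k) y)" by (rule tm)
      finally show ?thesis by (rule order_trans) simp
    next
      case 3
      from exists_dyadic_ge_1[OF this] obtain k
        where "2 ^ Suc k / 2 \<le> norm y" "norm y < 2 ^ Suc k" by auto
      then have "ennreal (qgrowth_kernel y) \<le> F (2 ^ Suc k) y" by (intro F) auto
      also have "\<dots> \<le> (\<Sum>k. F (2 ^ Suc k) y)" by (rule tm)
      finally show ?thesis by (rule order_trans) simp
    qed
  qed
  have [measurable]: "F R \<in> borel_measurable borel" for R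
    unfolding F_def by (intro borel_measurable_times_ennreal borel_measurable_const borel_measurable_indicator) auto
  have "(\<integral>\<^sup>+ y. ennreal (qgrowth_kernel (y :: real^'n)) \<partial>lborel)
      \<le> (\<integral>\<^sup>+ y. (\<Sum>k. F ((1/2) ^ k) y) + (\<Sum>k. F (2 ^ Suc k) y) \<partial>lborel)"
    by (intro nn_integral_mono le)
  also have "\<dots> = (\<integral>\<^sup>+ y. (\<Sum>k. F ((1/2) ^ k) y) \<partial>lborel) + (\<integral>\<^sup>+ y. (\<Sum>k. F (2 ^ Suc k) y) \<partial>lborel)"
    by (rule nn_integral_add) measurable
  also have "\<dots> < \<infinity>" using small large by simp
  finally show ?thesis by (intro integrableI_nonneg) auto
qed

section \<open>Mass and scaling of the kernel\<close>

definition qgrowth_mass :: "'n::finite itself \<Rightarrow> real" where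
  "qgrowth_mass _ = (LINT y|lborel. qgrowth_kernel (y :: real^'n))"

lemma qgrowth_mass_nonneg: "0 \<le> qgrowth_mass TYPE('n::finite)"
  unfolding qgrowth_mass_def by (rule integral_nonneg_AE) simp

text \<open>Affine substitution, giving integrability and value at once. It serves dilations of the
  kernel (c = 1/\<theta>) and the reflection z -> e - z in the coupling (c = -1).\<close>

lemma has_bochner_integral_lborel_affine:
  fixes f :: "'a::euclidean_space \<Rightarrow> real"
  assumes f: "integrable lborel f" and c: "c \<noteq> 0"
  shows "has_bochner_integral lborel (\<lambda>x. f (t + c *\<^sub>R x)) ((LINT x|lborel. f x) / \<bar>c\<bar> ^ DIM('a))"
proof -
  have [measurable]: "f \<in> borel_measurable borel" using borel_measurable_integrable[OF f] by simp
  have "integrable (density (distr lborel borel (\<lambda>x. t + c *\<^sub>R x)) (\<lambda>_. ennreal (\<bar>c\<bar> ^ DIM('a)))) f"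
    using f by (subst (asm) lborel_affine[OF c, of t]) simp
  then have 1: "integrable lborel (\<lambda>x. f (t + c *\<^sub>R x))"
    using c by (subst (asm) integrable_density) (auto simp: integrable_distr_eq)
  have "(LINT x|lborel. f x) = \<bar>c\<bar> ^ DIM('a) * (LINT x|lborel. f (t + c *\<^sub>R x))"
    by (subst lborel_affine[OF c, of t], subst integral_density) (auto simp: integral_distr)
  with 1 c show ?thesis by (simp add: has_bochner_integral_iff)
qed

text \<open>The measure |y|^-(n+1) dy is homogeneous of degree -1, whence the factor 1/\<theta>. It
  turns \<rho>^(2\<beta>) into \<rho>^(2\<beta> - 1) later on.\<close>

lemma has_bochner_integral_qgrowth_scaled:
  assumes "0 < \<theta>"
  shows "has_bochner_integral lborel
    (\<lambda>y::real^'n. qgrowth (norm y / \<theta>) / norm y ^ (CARD('n) + 1)) (qgrowth_mass TYPE('n) / \<theta>)"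
proof -
  have "has_bochner_integral lborel (\<lambda>y::real^'n. qgrowth_kernel (0 + (1 / \<theta>) *\<^sub>R y))
     (qgrowth_mass TYPE('n) / \<bar>1 / \<theta>\<bar> ^ DIM(real^'n))"
    unfolding qgrowth_mass_def using assms by (intro has_bochner_integral_lborel_affine integrable_qgrowth_kernel) auto
  from has_bochner_integral_mult_right[OF this, of "1 / \<theta> ^ (CARD('n) + 1)"]
  show ?thesis using assms by (simp add: qgrowth_kernel_def field_simps cong: has_bochner_integral_cong)
qed

section \<open>Tangent and increment bounds for concave powers\<close>

text \<open>Weighted AM-GM for P + z and P with weights \<beta> and 1 - \<beta>, divided by P^(1 -
  \<beta>). At P + z = 0 the right side is (1 - \<beta>) P^\<beta>.\<close>

lemma powr_tangent:
  fixes P z \<beta> :: real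
  assumes "0 < P" "0 \<le> P + z" "0 < \<beta>" "\<beta> \<le> 1"
  shows "(P + z) powr \<beta> \<le> P powr \<beta> + \<beta> * P powr (\<beta> - 1) * z"
proof (cases "P + z = 0")
  case True
  then have "z = - P" by simp
  then have "\<beta> * P powr (\<beta> - 1) * z = - (\<beta> * P powr \<beta>)"
    using assms by (simp add: powr_diff)
  also have "\<dots> \<ge> - (P powr \<beta>)" using assms by (simp add: mult_left_le_one_le)
  finally show ?thesis using True by simp
next
  case False
  then have "(P + z) powr \<beta> * P powr (1 - \<beta>) \<le> \<beta> * (P + z) + (1 - \<beta>) * P"
    using assms by (intro Youngs_inequality_0) auto
  also have "\<dots> = P + \<beta> * z" by (simp add: algebra_simps)
  finally have "(P + z) powr \<beta> \<le> (P + \<beta> * z) / P powr (1 - \<beta>)"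
    using assms by (simp add: pos_le_divide_eq)
  also have "\<dots> = P powr \<beta> + \<beta> * P powr (\<beta> - 1) * z"
    using assms by (simp add: powr_diff field_simps)
  finally show ?thesis .
qed

lemma powr_quarter: "0 \<le> (x::real) \<Longrightarrow> x powr (1 / 4) = sqrt (sqrt x)"
  using powr_powr[of x "1/2" "1/2"] by (simp add: powr_half_sqrt)

lemma powr_quarter_add_le:
  fixes x y :: real
  assumes "0 \<le> x" "0 \<le> y"
  shows "(x + y) powr (1 / 4) \<le> x powr (1 / 4) + y powr (1 / 4)"
proof -
  have "sqrt (sqrt (x + y)) \<le> sqrt (sqrt x + sqrt y)"
    using assms by (intro real_sqrt_le_mono sqrt_add_le_add_sqrt)
  also have "\<dots> \<le> sqrt (sqrt x) + sqrt (sqrt y)"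
    using assms by (intro sqrt_add_le_add_sqrt) auto
  finally show ?thesis using assms by (simp add: powr_quarter)
qed

text \<open>The quadratic bound comes from the tangent at P, the square root bound from comparison
  with the exponent 1/4, as (s^2)^(1/4) = sqrt s. Both keep a factor \<beta>, which makes these
  terms small for small exponents. P may be lowered to \<theta>^2 because only nonpositive powers of
  it occur.\<close>

lemma powr_increment_le_qgrowth:
  assumes "0 < \<theta>" "\<theta>\<^sup>2 \<le> P" "0 < \<beta>" "\<beta> \<le> 1 / 4" "0 \<le> s"
  shows "(P + s\<^sup>2) powr \<beta> - P powr \<beta> \<le> 4 * \<beta> * \<theta> powr (2 * \<beta>) * qgrowth (s / \<theta>)"
proof -
  have P: "0 < P" using assms by (smt (verit) zero_less_power)
  have \<theta>2: "(\<theta>\<^sup>2) powr x = \<theta> powr (2 * x)" for x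
    using assms by (simp add: powr_powr flip: powr_numeral)
  have "(P + s\<^sup>2) powr \<beta> - P powr \<beta> \<le> \<beta> * P powr (\<beta> - 1) * s\<^sup>2"
    using powr_tangent[of P "s\<^sup>2" \<beta>] assms P by simp
  also have "\<dots> \<le> \<beta> * (\<theta>\<^sup>2) powr (\<beta> - 1) * s\<^sup>2"
    using assms by (intro mult_right_mono mult_left_mono powr_mono2') auto
  also have "\<dots> = \<beta> * \<theta> powr (2 * \<beta>) * (s / \<theta>)\<^sup>2"
    using assms unfolding \<theta>2 by (simp add: powr_diff right_diff_distrib power_divide)
  also have "\<dots> \<le> 4 * \<beta> * \<theta> powr (2 * \<beta>) * (s / \<theta>)\<^sup>2"
    using assms by (intro mult_right_mono) auto
  finally have 1: "(P + s\<^sup>2) powr \<beta> - P powr \<beta> \<le> 4 * \<beta> * \<theta> powr (2 * \<beta>) * (s / \<theta>)\<^sup>2" .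
  define \<sigma> where "\<sigma> = s\<^sup>2 / P"
  have \<sigma>: "0 \<le> \<sigma>" using P by (simp add: \<sigma>_def)
  \<comment> \<open>Young's inequality between 1 and (1 + \<sigma>)^(1/4); plain subadditivity of
    the power \<beta> would lose the factor \<beta>.\<close>
  have "(1 + \<sigma>) powr \<beta> = ((1 + \<sigma>) powr (1 / 4)) powr (4 * \<beta>) * 1 powr (1 - 4 * \<beta>)"
    using \<sigma> by (simp add: powr_powr)
  also have "\<dots> \<le> 4 * \<beta> * (1 + \<sigma>) powr (1 / 4) + (1 - 4 * \<beta>) * 1"
    using assms \<sigma> by (intro Youngs_inequality_0) auto
  also have "\<dots> \<le> 4 * \<beta> * (1 powr (1 / 4) + \<sigma> powr (1 / 4)) + (1 - 4 * \<beta>) * 1"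
    using assms \<sigma> powr_quarter_add_le[of 1 \<sigma>] by (intro add_right_mono mult_left_mono) auto
  finally have *: "(1 + \<sigma>) powr \<beta> - 1 \<le> 4 * \<beta> * \<sigma> powr (1 / 4)" by (simp add: algebra_simps)
  have "(P + s\<^sup>2) powr \<beta> = P powr \<beta> * (1 + \<sigma>) powr \<beta>"
    using P \<sigma> by (subst powr_mult[symmetric]) (auto simp: \<sigma>_def distrib_left)
  then have "(P + s\<^sup>2) powr \<beta> - P powr \<beta> = P powr \<beta> * ((1 + \<sigma>) powr \<beta> - 1)"
    by (simp add: algebra_simps)
  also have "\<dots> \<le> P powr \<beta> * (4 * \<beta> * \<sigma> powr (1 / 4))"
    using * by (intro mult_left_mono) auto
  also have "\<dots> = 4 * \<beta> * P powr (\<beta> - 1 / 4) * sqrt s"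
    using P assms by (simp add: \<sigma>_def powr_divide powr_diff powr_quarter[of "s\<^sup>2"])
  also have "\<dots> \<le> 4 * \<beta> * (\<theta>\<^sup>2) powr (\<beta> - 1 / 4) * sqrt s"
    using assms by (intro mult_right_mono mult_left_mono powr_mono2') auto
  also have "\<dots> = 4 * \<beta> * \<theta> powr (2 * \<beta>) * sqrt (s / \<theta>)"
    using assms unfolding \<theta>2 by (simp add: powr_diff right_diff_distrib powr_half_sqrt real_sqrt_divide)
  finally show ?thesis using 1 by (simp add: qgrowth_def min_def)
qed

subsection \<open>Concave powers of a quadratic form\<close>

text \<open>With \<open>\<eta> = 0\<close> this is the Hoelder modulus, with \<open>\<eta> > 0\<close> a smooth barrier. Being a concave function
  of \<open>|p|\<close> squared, it lies below quadratic polynomials that touch it, with no Taylor expansion.\<close>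

definition soft_power :: "real \<Rightarrow> real \<Rightarrow> 'a::real_inner \<Rightarrow> real" where
  "soft_power \<beta> \<eta> p = ((norm p)\<^sup>2 + \<eta>\<^sup>2) powr \<beta>"

lemma soft_power_nonneg [simp]: "0 \<le> soft_power \<beta> \<eta> p"
  by (simp add: soft_power_def)

lemma soft_power_0: "soft_power \<beta> 0 p = norm p powr (2 * \<beta>)"
  by (cases "p = 0") (simp_all add: soft_power_def powr_powr flip: powr_numeral)

lemma soft_power_at_0: "0 < \<eta> \<Longrightarrow> soft_power \<beta> \<eta> 0 = \<eta> powr (2 * \<beta>)"
  by (simp add: soft_power_def powr_powr flip: powr_numeral)

lemma soft_power_mono: "0 \<le> \<beta> \<Longrightarrow> \<bar>\<eta>\<bar> \<le> \<bar>\<eta>'\<bar> \<Longrightarrow> soft_power \<beta> \<eta> p \<le> soft_power \<beta> \<eta>' p"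
  unfolding soft_power_def by (intro powr_mono2 add_left_mono) (auto simp: abs_le_square_iff)

lemma continuous_on_soft_power [continuous_intros]:
  assumes "continuous_on S f" "0 < \<beta>"
  shows "continuous_on S (\<lambda>x. soft_power \<beta> \<eta> (f x))"
  unfolding soft_power_def using assms by (intro continuous_on_powr' continuous_intros) auto

lemma norm_add_sq: "(norm (p + y))\<^sup>2 = (norm p)\<^sup>2 + (2 * (p \<bullet> y) + (norm y)\<^sup>2)"
  by (simp add: power2_norm_eq_inner inner_add_left inner_add_right inner_commute)

lemma soft_power_le_quadratic:
  assumes "0 < (norm p)\<^sup>2 + \<eta>\<^sup>2" "0 < \<beta>" "\<beta> \<le> 1"
  shows "soft_power \<beta> \<eta> (p + y) \<le> soft_power \<beta> \<eta> p
    + \<beta> * ((norm p)\<^sup>2 + \<eta>\<^sup>2) powr (\<beta> - 1) * (2 * (p \<bullet> y) + (norm y)\<^sup>2)"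
proof -
  have eq: "(norm (p + y))\<^sup>2 + \<eta>\<^sup>2 = ((norm p)\<^sup>2 + \<eta>\<^sup>2) + (2 * (p \<bullet> y) + (norm y)\<^sup>2)"
    by (simp add: norm_add_sq)
  have "0 \<le> (norm (p + y))\<^sup>2 + \<eta>\<^sup>2" by simp
  then show ?thesis
    unfolding soft_power_def eq using assms by (intro powr_tangent) auto
qed

text \<open>Both tangents are taken at Q = P + |y|^2, the mean of |p + y|^2 + \<eta>^2 and |p - y|^2
  + \<eta>^2. The linear terms then cancel and twice Q^\<beta> - P^\<beta> remains.\<close>

lemma soft_power_second_diff_le:
  assumes "0 < \<theta>" "\<theta>\<^sup>2 \<le> (norm p)\<^sup>2 + \<eta>\<^sup>2" "0 < \<beta>" "\<beta> \<le> 1 / 4"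
  shows "soft_power \<beta> \<eta> (p + y) + soft_power \<beta> \<eta> (p - y) - 2 * soft_power \<beta> \<eta> p
    \<le> 8 * \<beta> * \<theta> powr (2 * \<beta>) * qgrowth (norm y / \<theta>)"
proof -
  let ?P = "(norm p)\<^sup>2 + \<eta>\<^sup>2"
  define Q where "Q = ?P + (norm y)\<^sup>2"
  have "0 < ?P" using assms by (smt (verit) zero_less_power)
  then have Q: "0 < Q" by (simp add: Q_def add_pos_nonneg)
  have eq1: "(norm (p + y))\<^sup>2 + \<eta>\<^sup>2 = Q + 2 * (p \<bullet> y)"
    by (simp add: norm_add_sq Q_def)
  have eq2: "(norm (p - y))\<^sup>2 + \<eta>\<^sup>2 = Q + - (2 * (p \<bullet> y))"
    using norm_add_sq[of p "- y"] by (simp add: Q_def)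
  have "soft_power \<beta> \<eta> (p + y) \<le> Q powr \<beta> + \<beta> * Q powr (\<beta> - 1) * (2 * (p \<bullet> y))"
    unfolding soft_power_def eq1
    by (rule powr_tangent) (use Q assms in \<open>auto simp: eq1[symmetric]\<close>)
  moreover have "soft_power \<beta> \<eta> (p - y) \<le> Q powr \<beta> + \<beta> * Q powr (\<beta> - 1) * (- (2 * (p \<bullet> y)))"
    unfolding soft_power_def eq2
    by (rule powr_tangent) (use Q assms in \<open>auto simp: eq2[symmetric] simp del: add_uminus_conv_diff\<close>)
  moreover have "Q powr \<beta> - ?P powr \<beta> \<le> 4 * \<beta> * \<theta> powr (2 * \<beta>) * qgrowth (norm y / \<theta>)"
    unfolding Q_def using assms by (intro powr_increment_le_qgrowth) auto
  ultimately show ?thesis by (simp add: soft_power_def)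
qed

text \<open>Gives the quadratic test polynomial near the contact point the same majorant as the
  second differences farther out; s \<le> \<theta> places \<open>qgrowth\<close> in its quadratic
  range.\<close>

lemma soft_power_quadratic_le_qgrowth:
  assumes "0 < \<theta>" "\<theta>\<^sup>2 \<le> P" "0 < \<beta>" "\<beta> \<le> 1" "0 \<le> s" "s \<le> \<theta>"
  shows "2 * (\<beta> * P powr (\<beta> - 1)) * s\<^sup>2 \<le> 8 * \<beta> * \<theta> powr (2 * \<beta>) * qgrowth (s / \<theta>)"
proof -
  have \<theta>2: "(\<theta>\<^sup>2) powr x = \<theta> powr (2 * x)" for x
    using assms by (simp add: powr_powr flip: powr_numeral)
  have "2 * (\<beta> * P powr (\<beta> - 1)) * s\<^sup>2 \<le> 2 * (\<beta> * (\<theta>\<^sup>2) powr (\<beta> - 1)) * s\<^sup>2"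
    using assms by (intro mult_right_mono mult_left_mono powr_mono2') auto
  also have "\<dots> = 2 * \<beta> * \<theta> powr (2 * \<beta>) * (s / \<theta>)\<^sup>2"
    using assms unfolding \<theta>2 by (simp add: powr_diff right_diff_distrib power_divide)
  also have "\<dots> = 2 * \<beta> * \<theta> powr (2 * \<beta>) * qgrowth (s / \<theta>)"
    using assms by (subst qgrowth_eq_square) auto
  also have "\<dots> \<le> 8 * \<beta> * \<theta> powr (2 * \<beta>) * qgrowth (s / \<theta>)"
    using assms by (intro mult_right_mono) auto
  finally show ?thesis .
qed

text \<open>Since |p| is at most the square root of P = |p|^2 + \<eta>^2, the norm is at most
  2\<beta> P^(\<beta> - 1/2), which decreases in P.\<close>

lemma soft_power_gradient_le:
  assumes "0 < \<theta>" "\<theta>\<^sup>2 \<le> (norm p)\<^sup>2 + \<eta>\<^sup>2" "0 < \<beta>" "\<beta> \<le> 1 / 4"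
  shows "norm ((2 * (\<beta> * ((norm p)\<^sup>2 + \<eta>\<^sup>2) powr (\<beta> - 1))) *\<^sub>R p) \<le> 2 * \<beta> * \<theta> powr (2 * \<beta> - 1)"
proof -
  let ?P = "(norm p)\<^sup>2 + \<eta>\<^sup>2"
  have P: "0 < ?P" using assms by (smt (verit) zero_less_power)
  have \<theta>2: "(\<theta>\<^sup>2) powr x = \<theta> powr (2 * x)" for x
    using assms by (simp add: powr_powr flip: powr_numeral)
  have "norm p \<le> ?P powr (1 / 2)" by (simp add: powr_half_sqrt real_le_rsqrt)
  then have "2 * (\<beta> * ?P powr (\<beta> - 1)) * norm p \<le> 2 * (\<beta> * ?P powr (\<beta> - 1)) * ?P powr (1 / 2)"
    using assms by (intro mult_left_mono) auto
  also have "\<dots> = 2 * \<beta> * ?P powr (\<beta> - 1 / 2)"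
    using P by (simp flip: powr_add)
  also have "\<dots> \<le> 2 * \<beta> * (\<theta>\<^sup>2) powr (\<beta> - 1 / 2)"
    using assms by (intro mult_left_mono powr_mono2') auto
  finally show ?thesis using assms by (simp add: \<theta>2 right_diff_distrib)
qed

subsection \<open>Quadratic test functions\<close>

text \<open>The numerator in the integrand of \<open>Mplus\<close>. Its negative at -z is the
  numerator in \<open>Mminus\<close>, so both inequalities can be expressed through it.\<close>

definition extremal :: "real \<Rightarrow> real \<Rightarrow> real \<Rightarrow> real" where
  "extremal lam Lam z = Lam * pos_part z - lam * neg_part z"

text \<open>Contact is only tested in the past, so test functions that are affine in time suffice: a
  one-sided bound on the time increment absorbs any curvature. The radius \<open>r\<close> need not tend to \<open>0\<close>:
  the quadratic polynomial contributes no more in the ball than its counterpart outside.\<close>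

definition quad_test_ineq ::
  "real \<Rightarrow> real \<Rightarrow> real \<Rightarrow> real \<Rightarrow> ((real^'n) \<times> real \<Rightarrow> real) \<Rightarrow> bool" where
  "quad_test_ineq A lam Lam T u \<longleftrightarrow> (\<forall>x t b M c r. 0 < t \<and> t \<le> T \<and> 0 < r \<and>
     (\<forall>y s. norm y < r \<and> t - r < s \<and> s \<le> t \<and> 0 \<le> s \<longrightarrow>
        u (x + y, s) \<le> u (x, t) + b \<bullet> y + M * (norm y)\<^sup>2 + c * (s - t)) \<longrightarrow>
     c - A * norm b \<le> 1 / 2 * (LINT y|lborel.
        extremal lam Lam (if norm y < r then 2 * M * (norm y)\<^sup>2 else second_diff (\<lambda>z. u (z, t)) x y)
          / norm y ^ (CARD('n) + 1)))"

section \<open>From the viscosity definition to quadratic test functions\<close>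

definition quad_test :: "real \<Rightarrow> real^'n \<Rightarrow> real \<Rightarrow> real \<Rightarrow> real^'n \<Rightarrow> real \<Rightarrow> (real^'n) \<times> real \<Rightarrow> real" where
  "quad_test a b M c x t p = a + b \<bullet> (fst p - x) + M * (norm (fst p - x))\<^sup>2 + c * (snd p - t)"

lemma C2_quad_test: "C2 (quad_test a b M c x t :: (real^'n) \<times> real \<Rightarrow> real)"
proof -
  define G :: "(real^'n) \<times> real \<Rightarrow> (real^'n) \<times> real" where
    "G p = (b + (2 * M) *\<^sub>R (fst p - x), c)" for p
  define S :: "(real^'n) \<times> real \<Rightarrow> (real^'n) \<times> real" where
    "S h = ((2 * M) *\<^sub>R fst h, 0)" for h
  have S: "bounded_linear S"
    unfolding S_def
    by (intro bounded_linear_Pair bounded_linear_zero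
        bounded_linear_compose[OF bounded_linear_scaleR_right] bounded_linear_fst)
  have lin: "bounded_linear (\<lambda>h. blinfun_inner_right (S h))"
    by (rule bounded_linear_compose[OF bounded_linear_blinfun_inner_right S])
  show ?thesis
    unfolding C2_def
  proof (intro exI conjI allI)
    fix p
    show "(quad_test a b M c x t has_derivative blinfun_apply (blinfun_inner_right (G p))) (at p)"
      unfolding quad_test_def power2_norm_eq_inner
      by (rule has_derivative_eq_rhs, (rule derivative_intros refl)+)
         (auto simp: G_def fun_eq_iff inner_prod_def algebra_simps inner_commute inner_add_left inner_diff_left inner_diff_right)
    show "((\<lambda>p. blinfun_inner_right (G p)) has_derivative
        blinfun_apply (Blinfun (\<lambda>h. blinfun_inner_right (S h)))) (at p)"
    proof -
      \<comment> \<open>The gradient map is affine with linear part S, so its derivative is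
        constant.\<close>
      have eq: "(\<lambda>q. blinfun_inner_right (G q)) = (\<lambda>q. blinfun_inner_right (G 0) + blinfun_inner_right (S q))"
        by (rule ext, rule blinfun_eqI)
           (auto simp: G_def S_def blinfun.add_left inner_prod_def inner_add_left inner_diff_left algebra_simps)
      show ?thesis
        unfolding eq bounded_linear_Blinfun_apply[OF lin]
        using has_derivative_add[OF has_derivative_const bounded_linear_imp_has_derivative[OF lin]] by simp
    qed
    show "continuous_on UNIV (\<lambda>p :: (real^'n) \<times> real. Blinfun (\<lambda>h. blinfun_inner_right (S h)))"
      by (rule continuous_on_const)
  qed
qed

lemma quad_test_at [simp]: "quad_test a b M c x t (x, t) = a"
  by (simp add: quad_test_def)

lemma uminus_quad_test: "- quad_test a b M c x t p = quad_test (- a) (- b) (- M) (- c) x t p"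
  by (simp add: quad_test_def)

context
  fixes u :: "(real^'n) \<times> real \<Rightarrow> real" and x b :: "real^'n" and a M c t r :: real
  assumes r: "0 < r" and a: "u (x, t) = a"
begin

lemma deriv_glue_quad_test: "deriv (\<lambda>s. glue (quad_test a b M c x t) u x t r (x, s)) t = c"
proof (rule DERIV_imp_deriv)
  have "((\<lambda>s. quad_test a b M c x t (x, s)) has_real_derivative c) (at t)"
    unfolding quad_test_def by (auto intro!: derivative_eq_intros)
  moreover have "\<forall>\<^sub>F s in nhds t. quad_test a b M c x t (x, s) = glue (quad_test a b M c x t) u x t r (x, s)"
    using eventually_nhds_in_open[of "{t - r<..<t + r}" t] r
    by (auto elim!: eventually_mono simp: glue_def)
  ultimately show "((\<lambda>s. glue (quad_test a b M c x t) u x t r (x, s)) has_real_derivative c) (at t)"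
    by (subst (asm) DERIV_cong_ev[OF refl _ refl]) auto
qed

lemma grad_glue_quad_test: "grad (\<lambda>y. glue (quad_test a b M c x t) u x t r (y, t)) x = b"
proof -
  let ?w = "\<lambda>y. glue (quad_test a b M c x t) u x t r (y, t)"
  have "((\<lambda>y. quad_test a b M c x t (y, t)) has_derivative (\<lambda>h. h \<bullet> b)) (at x)"
    unfolding quad_test_def power2_norm_eq_inner
    by (rule has_derivative_eq_rhs, (rule derivative_intros refl)+) (auto simp: inner_commute)
  then have *: "(?w has_derivative (\<lambda>h. h \<bullet> b)) (at x)"
    by (rule has_derivative_transform_within_open[of _ _ _ _ "ball x r"]) (use r in \<open>auto simp: glue_def\<close>)
  \<comment> \<open>\<open>grad\<close> is a definite description, so its value requires uniqueness;
    testing with the vector D - b gives it.\<close>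
  have "D = b" if "(?w has_derivative (\<lambda>h. h \<bullet> D)) (at x)" for D
  proof -
    have "(\<lambda>h. h \<bullet> D) = (\<lambda>h. h \<bullet> b)" using has_derivative_unique[OF that *] .
    then have "(D - b) \<bullet> D = (D - b) \<bullet> b" by meson
    then have "(D - b) \<bullet> (D - b) = 0" by (simp only: inner_diff_right diff_self)
    then show ?thesis by simp
  qed
  then show ?thesis
    unfolding grad_def gderiv_def using * by (intro the_equality) auto
qed

text \<open>The points x + y and x - y lie in the ball together or outside it together, and the
  centre value is u(x, t) either way, so there is no mixed case.\<close>

lemma second_diff_glue_quad_test:
  "second_diff (\<lambda>y. glue (quad_test a b M c x t) u x t r (y, t)) x y =
     (if norm y < r then 2 * M * (norm y)\<^sup>2 else second_diff (\<lambda>z. u (z, t)) x y)"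
  using r a by (auto simp: second_diff_def glue_def dist_norm quad_test_def)

end

lemma touches_above_quad_test:
  fixes u :: "(real^'n) \<times> real \<Rightarrow> real"
  assumes "0 < r" and
    "\<And>y s. norm y < r \<and> t - r < s \<and> s \<le> t \<and> 0 \<le> s \<Longrightarrow>
        u (x + y, s) \<le> u (x, t) + b \<bullet> y + M * (norm y)\<^sup>2 + c * (s - t)"
  shows "touches_above (quad_test (u (x, t)) b M c x t) u x t r"
  unfolding touches_above_def
proof (intro conjI allI impI)
  fix y s assume *: "norm (x - y) < r \<and> t - r < s \<and> s \<le> t \<and> 0 \<le> s"
  show "u (y, s) \<le> quad_test (u (x, t)) b M c x t (y, s)"
    using assms(2)[of "y - x" s] * by (simp add: quad_test_def norm_minus_commute)
qed (use assms in auto)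

lemma viscosity_sub_imp_quad_test_ineq:
  fixes u :: "(real^'n) \<times> real \<Rightarrow> real"
  assumes "viscosity_sub A lam Lam T' u" "T \<le> T'"
  shows "quad_test_ineq A lam Lam T u"
  unfolding quad_test_ineq_def
proof (intro allI impI, elim conjE)
  fix x b :: "real^'n" and t M c r :: real
  assume t: "0 < t" "t \<le> T" and r: "0 < r"
    and u: "\<forall>y s. norm y < r \<and> t - r < s \<and> s \<le> t \<and> 0 \<le> s \<longrightarrow>
        u (x + y, s) \<le> u (x, t) + b \<bullet> y + M * (norm y)\<^sup>2 + c * (s - t)"
  let ?\<phi> = "quad_test (u (x, t)) b M c x t"
  have "touches_above ?\<phi> u x t r" using r u by (intro touches_above_quad_test) auto
  then have "let v = glue ?\<phi> u x t r in deriv (\<lambda>s. v (x, s)) t - A * norm (grad (\<lambda>y. v (y, t)) x)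
            - Mplus lam Lam (\<lambda>y. v (y, t)) x \<le> 0"
    using assms t C2_quad_test unfolding viscosity_sub_def by (meson order_trans)
  then show "c - A * norm b \<le> 1 / 2 * (LINT y|lborel.
        extremal lam Lam (if norm y < r then 2 * M * (norm y)\<^sup>2 else second_diff (\<lambda>z. u (z, t)) x y)
          / norm y ^ (CARD('n) + 1))"
    unfolding Let_def Mplus_def deriv_glue_quad_test[OF r refl] grad_glue_quad_test[OF r refl]
      second_diff_glue_quad_test[OF r refl] extremal_def by simp
qed

text \<open>By the duality of M^- at w and -M^+ at -w, the supersolution inequality for u becomes a
  subsolution inequality for -u. Later arguments treat u and -u alike through
  \<open>quad_test_ineq\<close>.\<close>

lemma viscosity_super_imp_quad_test_ineq:
  fixes u :: "(real^'n) \<times> real \<Rightarrow> real"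
  assumes "viscosity_super A lam Lam T' u" "T \<le> T'"
  shows "quad_test_ineq A lam Lam T (\<lambda>p. - u p)"
  unfolding quad_test_ineq_def
proof (intro allI impI, elim conjE)
  fix x b :: "real^'n" and t M c r :: real
  assume t: "0 < t" "t \<le> T" and r: "0 < r"
    and u: "\<forall>y s. norm y < r \<and> t - r < s \<and> s \<le> t \<and> 0 \<le> s \<longrightarrow>
        - u (x + y, s) \<le> - u (x, t) + b \<bullet> y + M * (norm y)\<^sup>2 + c * (s - t)"
  let ?\<phi> = "quad_test (u (x, t)) (- b) (- M) (- c) x t"
  let ?d = "\<lambda>y. if norm y < r then 2 * M * (norm y)\<^sup>2 else second_diff (\<lambda>z. - u (z, t)) x y"
  have "touches_above (quad_test (- u (x, t)) b M c x t) (\<lambda>p. - u p) x t r"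
    using r u touches_above_quad_test[of r t "\<lambda>p. - u p" x b M c] by auto
  then have "touches_below ?\<phi> u x t r"
    unfolding touches_above_def touches_below_def
    using uminus_quad_test[of "u (x, t)" "- b" "- M" "- c" x t] by (simp add: le_minus_iff) (metis neg_le_iff_le)
  then have "let v = glue ?\<phi> u x t r in deriv (\<lambda>s. v (x, s)) t + A * norm (grad (\<lambda>y. v (y, t)) x)
            - Mminus lam Lam (\<lambda>y. v (y, t)) x \<ge> 0"
    using assms t C2_quad_test unfolding viscosity_super_def by (meson order_trans)
  moreover have "(if norm y < r then 2 * (- M) * (norm y)\<^sup>2 else second_diff (\<lambda>z. u (z, t)) x y) = - ?d y" for y
    by (simp add: second_diff_def)
  ultimately have 1: "c - A * norm b \<le> - (1 / 2 * (LINT y|lborel.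
     (lam * pos_part (- ?d y) - Lam * neg_part (- ?d y)) / norm y ^ (CARD('n) + 1)))"
    unfolding Let_def Mminus_def deriv_glue_quad_test[OF r refl] grad_glue_quad_test[OF r refl]
      second_diff_glue_quad_test[OF r refl] norm_minus_cancel
    by simp
  have 2: "(lam * pos_part (- z) - Lam * neg_part (- z)) / k = - (extremal lam Lam z / k)" for z k
    by (simp add: extremal_def pos_part_def neg_part_def algebra_simps diff_divide_distrib)
  show "c - A * norm b \<le> 1 / 2 * (LINT y|lborel. extremal lam Lam (?d y) / norm y ^ (CARD('n) + 1))"
    using 1 unfolding 2 by simp
qed

lemma quad_test_ineqD:
  fixes u :: "(real^'n) \<times> real \<Rightarrow> real"
  assumes "quad_test_ineq A lam Lam T u" "0 < t" "t \<le> T" "0 < r"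
    "\<And>y s. \<lbrakk>norm y < r; t - r < s; s \<le> t; 0 \<le> s\<rbrakk> \<Longrightarrow>
        u (x + y, s) \<le> u (x, t) + b \<bullet> y + M * (norm y)\<^sup>2 + c * (s - t)"
  shows "c - A * norm b \<le> 1 / 2 * (LINT y|lborel.
        extremal lam Lam (if norm y < r then 2 * M * (norm y)\<^sup>2 else second_diff (\<lambda>z. u (z, t)) x y)
          / norm y ^ (CARD('n) + 1))"
  using assms(1) unfolding quad_test_ineq_def using assms(2-) by blast

section \<open>Bounds for the extremal integral at a contact point\<close>

text \<open>Splits off a linear part, in which negative values of z can be exploited by the
  coupling. For lam \<le> Lam the rest is nonnegative and calls only for an upper bound of the
  positive part.\<close>

lemma extremal_eq: "extremal lam Lam z = lam * z + (Lam - lam) * pos_part z"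
  by (simp add: extremal_def pos_part_def neg_part_def max_def algebra_simps)

lemma borel_measurable_extremal [measurable]: "extremal lam Lam \<in> borel_measurable borel"
  unfolding extremal_def[abs_def] pos_part_def neg_part_def by measurable

lemma abs_extremal_le:
  assumes "0 < lam" "lam \<le> Lam"
  shows "\<bar>extremal lam Lam z\<bar> \<le> Lam * \<bar>z\<bar>"
proof (cases "0 \<le> z")
  case True then show ?thesis using assms by (simp add: extremal_def pos_part_def neg_part_def)
next
  case False
  then have "\<bar>extremal lam Lam z\<bar> = lam * \<bar>z\<bar>"
    using assms by (simp add: extremal_def pos_part_def neg_part_def abs_mult)
  also have "\<dots> \<le> Lam * \<bar>z\<bar>" using assms by (intro mult_right_mono) auto
  finally show ?thesis .
qed

lemma integrable_kernel:
  fixes f :: "real^'n \<Rightarrow> real"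
  assumes [measurable]: "f \<in> borel_measurable borel" and f: "\<And>y. \<bar>f y\<bar> \<le> K * qgrowth (norm y)"
  shows "integrable lborel (\<lambda>y. f y / norm y ^ (CARD('n) + 1))"
proof (rule Bochner_Integration.integrable_bound)
  show "integrable lborel (\<lambda>y::real^'n. K * qgrowth_kernel y)"
    by (intro integrable_mult_right integrable_qgrowth_kernel)
  show "AE y in lborel. norm (f y / norm y ^ (CARD('n) + 1)) \<le> norm (K * qgrowth_kernel y)"
  proof (intro AE_I2)
    fix y :: "real^'n"
    have "norm (f y / norm y ^ (CARD('n) + 1)) \<le> K * qgrowth (norm y) / norm y ^ (CARD('n) + 1)"
      using f[of y] by (simp add: divide_right_mono)
    also have "\<dots> = K * qgrowth_kernel y" by (simp add: qgrowth_kernel_def)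
    finally show "norm (f y / norm y ^ (CARD('n) + 1)) \<le> norm (K * qgrowth_kernel y)" by simp
  qed
qed measurable

text \<open>For r \<le> 1 the quadratic branch is a multiple of \<open>qgrowth\<close>. On the other
  branch |y| \<ge> r, where \<open>qgrowth\<close> is bounded below and the second difference is at
  most 4 N.\<close>

lemma touched_diff_bound:
  fixes w :: "real^'n \<Rightarrow> real"
  assumes w: "\<And>z. \<bar>w z\<bar> \<le> N" and r: "0 < r" "r \<le> 1"
  shows "\<exists>K. \<forall>y. \<bar>if norm y < r then 2 * M * (norm y)\<^sup>2 else second_diff w x y\<bar> \<le> K * qgrowth (norm y)"
proof (intro exI allI)
  fix y :: "real^'n"
  let ?K = "2 * \<bar>M\<bar> + 4 * N / qgrowth r"
  have N: "0 \<le> N" using w[of 0] by linarith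
  have gr: "0 < qgrowth r" using r by (intro qgrowth_pos) auto
  show "\<bar>if norm y < r then 2 * M * (norm y)\<^sup>2 else second_diff w x y\<bar> \<le> ?K * qgrowth (norm y)"
  proof (cases "norm y < r")
    case True
    have "\<bar>2 * M * (norm y)\<^sup>2\<bar> = 2 * \<bar>M\<bar> * qgrowth (norm y)"
      using True r by (subst qgrowth_eq_square) (auto simp: abs_mult)
    also have "\<dots> \<le> ?K * qgrowth (norm y)" using N gr by (intro mult_right_mono) auto
    finally show ?thesis using True by simp
  next
    case False
    have "\<bar>second_diff w x y\<bar> \<le> 4 * N"
      using w[of "x + y"] w[of "x - y"] w[of x] unfolding second_diff_def by linarith
    also have "\<dots> \<le> 4 * N / qgrowth r * qgrowth (norm y)"
      using N gr qgrowth_mono[of r "norm y"] r False by (simp add: field_simps mult_left_mono)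
    also have "\<dots> \<le> ?K * qgrowth (norm y)" by (intro mult_right_mono) auto
    finally show ?thesis using False by simp
  qed
qed

lemma touched_diff_measurable:
  fixes w :: "real^'n \<Rightarrow> real"
  assumes "continuous_on UNIV w"
  shows "(\<lambda>y. if norm y < r then 2 * M * (norm y)\<^sup>2 else second_diff w x y) \<in> borel_measurable borel"
proof -
  have "continuous_on UNIV (\<lambda>y. w (x + y))" "continuous_on UNIV (\<lambda>y. w (x - y))"
    by (intro continuous_on_compose2[OF assms] continuous_intros subset_UNIV)+
  then have [measurable]: "(\<lambda>y. w (x + y)) \<in> borel_measurable borel" "(\<lambda>y. w (x - y)) \<in> borel_measurable borel"
    by (auto intro: borel_measurable_continuous_onI)
  show ?thesis unfolding second_diff_def by measurable
qed

text \<open>A one-sided bound by H \<ge> 0 controls the positive part of d. The integral of d itself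
  is kept in the estimate, so that its negative contributions stay available.\<close>

lemma touched_integral_le:
  fixes w H :: "real^'n \<Rightarrow> real" and x :: "real^'n" and M :: real
  assumes par: "0 < lam" "lam \<le> Lam"
    and w: "continuous_on UNIV w" "\<And>z. \<bar>w z\<bar> \<le> N" and r: "0 < r" "r \<le> 1"
  defines "d \<equiv> \<lambda>y. if norm y < r then 2 * M * (norm y)\<^sup>2 else second_diff w x y"
  assumes H: "integrable lborel (\<lambda>y. H y / norm y ^ (CARD('n) + 1))" "\<And>y. 0 \<le> H y" "\<And>y. d y \<le> H y"
  shows "integrable lborel (\<lambda>y. d y / norm y ^ (CARD('n) + 1))"
    and "(LINT y|lborel. extremal lam Lam (d y) / norm y ^ (CARD('n) + 1))
      \<le> lam * (LINT y|lborel. d y / norm y ^ (CARD('n) + 1))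
        + (Lam - lam) * (LINT y|lborel. H y / norm y ^ (CARD('n) + 1))"
proof -
  have [measurable]: "d \<in> borel_measurable borel"
    unfolding d_def by (rule touched_diff_measurable[OF w(1)])
  obtain K where K: "\<And>y. \<bar>d y\<bar> \<le> K * qgrowth (norm y)"
    using touched_diff_bound[of w N r M x] w r unfolding d_def by auto
  show int_d: "integrable lborel (\<lambda>y. d y / norm y ^ (CARD('n) + 1))"
    by (rule integrable_kernel[OF _ K]) measurable
  have "\<bar>extremal lam Lam (d y)\<bar> \<le> (Lam * K) * qgrowth (norm y)" for y
  proof -
    have "\<bar>extremal lam Lam (d y)\<bar> \<le> Lam * \<bar>d y\<bar>" by (rule abs_extremal_le) fact+
    also have "\<dots> \<le> Lam * (K * qgrowth (norm y))" using K par by (intro mult_left_mono) auto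
    finally show ?thesis by (simp add: mult.assoc)
  qed
  then have int_e: "integrable lborel (\<lambda>y. extremal lam Lam (d y) / norm y ^ (CARD('n) + 1))"
    by (rule integrable_kernel[rotated]) measurable
  have "(LINT y|lborel. extremal lam Lam (d y) / norm y ^ (CARD('n) + 1))
     \<le> (LINT y|lborel. lam * (d y / norm y ^ (CARD('n) + 1)) + (Lam - lam) * (H y / norm y ^ (CARD('n) + 1)))"
  proof (rule integral_mono[OF int_e])
    show "integrable lborel (\<lambda>y. lam * (d y / norm y ^ (CARD('n) + 1)) + (Lam - lam) * (H y / norm y ^ (CARD('n) + 1)))"
      by (intro Bochner_Integration.integrable_add integrable_mult_right int_d H(1))
    fix y :: "real^'n"
    have "pos_part (d y) \<le> H y" using H(2,3)[of y] by (simp add: pos_part_def)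
    then have "extremal lam Lam (d y) \<le> lam * d y + (Lam - lam) * H y"
      unfolding extremal_eq using par by (intro add_left_mono mult_left_mono) auto
    then have "extremal lam Lam (d y) / norm y ^ (CARD('n) + 1) \<le> (lam * d y + (Lam - lam) * H y) / norm y ^ (CARD('n) + 1)"
      by (intro divide_right_mono) auto
    then show "extremal lam Lam (d y) / norm y ^ (CARD('n) + 1)
       \<le> lam * (d y / norm y ^ (CARD('n) + 1)) + (Lam - lam) * (H y / norm y ^ (CARD('n) + 1))"
      by (simp add: add_divide_distrib)
  qed
  also have "\<dots> = lam * (LINT y|lborel. d y / norm y ^ (CARD('n) + 1))
        + (Lam - lam) * (LINT y|lborel. H y / norm y ^ (CARD('n) + 1))"
    by (simp only: Bochner_Integration.integral_add[OF integrable_mult_right[OF int_d] integrable_mult_right[OF H(1)]]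
        integral_mult_right_zero)
  finally show "(LINT y|lborel. extremal lam Lam (d y) / norm y ^ (CARD('n) + 1)) \<le> \<dots>" .
qed

lemma soft_power_coercive:
  assumes "0 < \<beta>"
  shows "\<exists>R>0. \<forall>p::'a::real_inner. R \<le> norm p \<longrightarrow> Y \<le> soft_power \<beta> \<eta> p"
proof (intro exI conjI allI impI)
  let ?R = "max Y 1 powr (1 / (2 * \<beta>))"
  show "0 < ?R" by simp
  fix p :: 'a assume p: "?R \<le> norm p"
  have "Y \<le> max Y 1" by simp
  also have "\<dots> = ?R powr (2 * \<beta>)" using assms by (simp add: powr_powr)
  also have "\<dots> \<le> norm p powr (2 * \<beta>)" using p assms by (intro powr_mono2) auto
  also have "\<dots> = soft_power \<beta> 0 p" by (simp add: soft_power_0)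
  also have "\<dots> \<le> soft_power \<beta> \<eta> p" using assms by (intro soft_power_mono) auto
  finally show "Y \<le> soft_power \<beta> \<eta> p" .
qed

subsection \<open>Barriers and coupling\<close>

text \<open>The barrier is a strict supersolution. With X = L \<eta>^(2\<beta> - 1) and G the kernel
  mass, its gradient is at most X and its integral term at most Lam G X, while its speed is K = (A +
  Lam G + 1) X. A positive maximum of the excess of u is a contact point and would force K \<le> (A
  + Lam G) X.\<close>

lemma barrier_comparison:
  fixes u :: "(real^'n) \<times> real \<Rightarrow> real"
  assumes par: "0 \<le> A" "0 < lam" "lam \<le> Lam"
    and touch: "quad_test_ineq A lam Lam T u"
    and cont: "continuous_on (UNIV \<times> {0..T}) u"
    and bdd: "\<And>x t. t \<in> {0..T} \<Longrightarrow> \<bar>u (x, t)\<bar> \<le> N"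
    and \<beta>: "0 < \<beta>" "\<beta> \<le> 1 / 4" and \<eta>: "0 < \<eta>" and L: "0 < L" and s0: "0 \<le> s0"
    and init: "\<And>x. u (x, s0) \<le> a + L * soft_power \<beta> \<eta> (x - x0)"
    and t1: "s0 \<le> t1" "t1 \<le> T"
  shows "u (x1, t1) \<le> a + L * soft_power \<beta> \<eta> (x1 - x0)
    + (A + Lam * qgrowth_mass TYPE('n) + 1) * (L * \<eta> powr (2 * \<beta> - 1)) * (t1 - s0)"
proof (rule ccontr)
  let ?G = "qgrowth_mass TYPE('n)"
  define X where "X = L * \<eta> powr (2 * \<beta> - 1)"
  define K where "K = (A + Lam * ?G + 1) * X"
  define \<Psi> where "\<Psi> p = u p - a - L * soft_power \<beta> \<eta> (fst p - x0) - K * (snd p - s0)" for p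
  assume "\<not> ?thesis"
  then have pos: "0 < \<Psi> (x1, t1)" by (simp add: \<Psi>_def K_def X_def)
  have X: "0 < X" using L \<eta> by (simp add: X_def)
  have K: "0 \<le> K" using X par qgrowth_mass_nonneg[where 'n = 'n] by (simp add: K_def)
  obtain R where R: "0 < R" "\<And>p::real^'n. R \<le> norm p \<Longrightarrow> (N + \<bar>a\<bar>) / L \<le> soft_power \<beta> \<eta> p"
    using soft_power_coercive[OF \<beta>(1)] by metis
  \<comment> \<open>Beyond radius R the barrier dominates N; the second entry of the maximum puts
    the assumed violation into S.\<close>
  define S where "S = cball x0 (max R (dist x0 x1)) \<times> {s0..T}"
  have "compact S" unfolding S_def by (intro compact_Times compact_cball compact_Icc)
  moreover have x1: "(x1, t1) \<in> S" using t1 by (auto simp: S_def)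
  moreover have "continuous_on S \<Psi>"
    unfolding \<Psi>_def
    by (intro continuous_intros continuous_on_subset[OF cont]) (use s0 \<beta> in \<open>auto simp: S_def\<close>)
  ultimately obtain q where q: "q \<in> S" "\<And>p. p \<in> S \<Longrightarrow> \<Psi> p \<le> \<Psi> q"
    by (metis continuous_attains_sup empty_iff)
  obtain x t where xt: "q = (x, t)" by (cases q)
  have gt0: "0 < \<Psi> (x, t)" using q(2)[OF x1] pos xt by simp
  have t: "s0 < t" "t \<le> T"
    using gt0 init[of x] q(1) xt by (auto simp: S_def \<Psi>_def order.order_iff_strict)
  have max: "\<Psi> (y, s) \<le> \<Psi> (x, t)" if "s0 \<le> s" "s \<le> T" for y s
  proof (cases "(y, s) \<in> S")
    case True then show ?thesis using q xt by auto
  next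
    case False
    then have "R \<le> norm (y - x0)" using that by (auto simp: S_def dist_norm norm_minus_commute)
    from R(2)[OF this] have "N + \<bar>a\<bar> \<le> L * soft_power \<beta> \<eta> (y - x0)"
      using L by (simp add: divide_le_eq mult.commute)
    moreover have "u (y, s) \<le> N" using bdd[of s y] that s0 by auto
    moreover have "0 \<le> K * (s - s0)" using K that by simp
    ultimately have "\<Psi> (y, s) \<le> 0" unfolding \<Psi>_def by simp
    then show ?thesis using gt0 by simp
  qed
  define p where "p = x - x0"
  define P where "P = (norm p)\<^sup>2 + \<eta>\<^sup>2"
  have P: "\<eta>\<^sup>2 \<le> P" "0 < P" using \<eta> by (auto simp: P_def add_nonneg_pos)
  define B where "B = \<beta> * P powr (\<beta> - 1)"
  define b where "b = L *\<^sub>R ((2 * B) *\<^sub>R p)"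
  \<comment> \<open>The cap \<eta> serves the quadratic majorant, 1 serves integrability, and t - s0
    keeps the past window in times after s0.\<close>
  define r where "r = min (min \<eta> 1) (t - s0)"
  have r: "0 < r" "r \<le> 1" "r \<le> \<eta>" "r \<le> t - s0" using \<eta> t by (auto simp: r_def)
  let ?d = "\<lambda>y. if norm y < r then 2 * (L * B) * (norm y)\<^sup>2 else second_diff (\<lambda>z. u (z, t)) x y"
  let ?H = "\<lambda>y::real^'n. 8 * \<beta> * L * \<eta> powr (2 * \<beta>) * qgrowth (norm y / \<eta>)"
  let ?h = "LINT y|lborel. ?H y / norm y ^ (CARD('n) + 1)"
  have h: "has_bochner_integral lborel (\<lambda>y. ?H y / norm y ^ (CARD('n) + 1))
      (8 * \<beta> * L * \<eta> powr (2 * \<beta>) * (?G / \<eta>))"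
    using has_bochner_integral_mult_right[OF has_bochner_integral_qgrowth_scaled[OF \<eta>, where 'n = 'n]] by simp
  have "u (x + y, s) \<le> u (x, t) + b \<bullet> y + (L * B) * (norm y)\<^sup>2 + K * (s - t)"
    if "norm y < r" "t - r < s" "s \<le> t" for y s
  proof -
    have "\<Psi> (x + y, s) \<le> \<Psi> (x, t)" using that r t by (intro max) auto
    moreover have "L * soft_power \<beta> \<eta> (p + y) \<le> L * (soft_power \<beta> \<eta> p + B * (2 * (p \<bullet> y) + (norm y)\<^sup>2))"
      unfolding B_def P_def using L P \<beta> by (intro mult_left_mono soft_power_le_quadratic) (auto simp: P_def)
    ultimately show ?thesis
      by (simp add: \<Psi>_def p_def b_def algebra_simps)
  qed
  then have visc: "K - A * norm b \<le> 1 / 2 * (LINT y|lborel. extremal lam Lam (?d y) / norm y ^ (CARD('n) + 1))"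
    using t s0 r by (intro quad_test_ineqD[OF touch]) auto
  have d_le: "?d y \<le> ?H y" for y
  proof (cases "norm y < r")
    case True
    have "L * (2 * B * (norm y)\<^sup>2) \<le> L * (8 * \<beta> * \<eta> powr (2 * \<beta>) * qgrowth (norm y / \<eta>))"
      unfolding B_def using L P \<beta> \<eta> True r by (intro mult_left_mono soft_power_quadratic_le_qgrowth) auto
    then show ?thesis using True by (simp add: mult_ac)
  next
    case False
    have "\<Psi> (x + y, t) \<le> \<Psi> (x, t)" "\<Psi> (x - y, t) \<le> \<Psi> (x, t)" using t by (auto intro!: max)
    then have "second_diff (\<lambda>z. u (z, t)) x y \<le> L * (soft_power \<beta> \<eta> (p + y) + soft_power \<beta> \<eta> (p - y) - 2 * soft_power \<beta> \<eta> p)"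
      by (simp add: \<Psi>_def second_diff_def p_def algebra_simps)
    also have "\<dots> \<le> L * (8 * \<beta> * \<eta> powr (2 * \<beta>) * qgrowth (norm y / \<eta>))"
      using L P \<beta> \<eta> by (intro mult_left_mono soft_power_second_diff_le) (auto simp: P_def)
    finally show ?thesis using False by (simp add: mult_ac)
  qed
  have "(LINT y|lborel. extremal lam Lam (?d y) / norm y ^ (CARD('n) + 1))
      \<le> Lam * (8 * \<beta> * L * \<eta> powr (2 * \<beta>) * (?G / \<eta>))"
  proof -
    have cu: "continuous_on UNIV (\<lambda>z. u (z, t))"
      using t s0 by (intro continuous_on_compose2[OF cont] continuous_intros) auto
    have H0: "0 \<le> ?H y" for y using \<beta> L \<eta> by simp
    have H1: "integrable lborel (\<lambda>y. ?H y / norm y ^ (CARD('n) + 1))"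
      using h by (simp add: has_bochner_integral_iff)
    have bu: "\<bar>u (z, t)\<bar> \<le> N" for z using bdd t s0 by auto
    note I = touched_integral_le[OF par(2,3) cu bu r(1,2) H1 H0 d_le]
    have "(LINT y|lborel. ?d y / norm y ^ (CARD('n) + 1)) \<le> ?h"
      using I(1) H1 d_le by (intro integral_mono divide_right_mono) auto
    then have "lam * (LINT y|lborel. ?d y / norm y ^ (CARD('n) + 1)) \<le> lam * ?h"
      using par by (intro mult_left_mono) auto
    then have "lam * (LINT y|lborel. ?d y / norm y ^ (CARD('n) + 1)) + (Lam - lam) * ?h \<le> Lam * ?h"
      unfolding left_diff_distrib by simp
    with I(2) have "(LINT y|lborel. extremal lam Lam (?d y) / norm y ^ (CARD('n) + 1)) \<le> Lam * ?h"
      by (rule order_trans)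
    then show ?thesis unfolding has_bochner_integral_integral_eq[OF h] .
  qed
  then have "K - A * norm b \<le> 1 / 2 * (Lam * (8 * \<beta> * L * \<eta> powr (2 * \<beta>) * (?G / \<eta>)))"
    by (intro order_trans[OF visc] mult_left_mono) auto
  also have "\<dots> = 1 / 2 * (8 * \<beta> * (Lam * ?G * X))"
    using \<eta> by (simp add: X_def powr_diff)
  \<comment> \<open>\<beta> \<le> 1/4 gives 8\<beta> \<le> 2, which cancels the factor 1/2 of the
    operator.\<close>
  also have "\<dots> \<le> 1 / 2 * (2 * (Lam * ?G * X))"
    using \<beta> par X qgrowth_mass_nonneg[where 'n = 'n] by (intro mult_left_mono mult_right_mono) auto
  finally have 1: "K - A * norm b \<le> Lam * ?G * X" by simp
  have "norm ((2 * B) *\<^sub>R p) \<le> 2 * \<beta> * \<eta> powr (2 * \<beta> - 1)"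
    unfolding B_def P_def using P \<beta> \<eta> by (intro soft_power_gradient_le) (auto simp: P_def)
  then have "L * norm ((2 * B) *\<^sub>R p) \<le> L * (2 * \<beta> * \<eta> powr (2 * \<beta> - 1))"
    using L by (intro mult_left_mono) auto
  moreover have "norm b = L * norm ((2 * B) *\<^sub>R p)"
    using L unfolding b_def by (subst norm_scaleR) simp
  ultimately have "norm b \<le> 2 * \<beta> * X" by (simp add: X_def mult_ac)
  also have "\<dots> \<le> 1 * X" using \<beta> X by (intro mult_right_mono) auto
  finally have "A * norm b \<le> A * X" using par by (intro mult_left_mono) auto
  with 1 X show False by (simp add: K_def algebra_simps)
qed

text \<open>The functions \<open>d1\<close> and \<open>d2\<close> play the role of the second differences of \<open>u\<close> at \<open>x\<close> and of \<open>-u\<close> at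
  \<open>x + e\<close>. The reflection \<open>z \<mapsto> e - z\<close> pairs jumps from the two points to the same landing point.\<close>

lemma coupling_gain:
  fixes d1 d2 H1 H2 :: "real^'n \<Rightarrow> real" and e :: "real^'n"
  assumes int: "integrable lborel (\<lambda>z. d1 z / norm z ^ (CARD('n) + 1))"
      "integrable lborel (\<lambda>z. d2 z / norm z ^ (CARD('n) + 1))"
      "integrable lborel (\<lambda>z. H1 z / norm z ^ (CARD('n) + 1))"
      "integrable lborel (\<lambda>z. H2 z / norm z ^ (CARD('n) + 1))"
    and le: "\<And>z. d1 z \<le> H1 z" "\<And>z. d2 z \<le> H2 z"
    and nonneg: "\<And>z. 0 \<le> H1 z" "\<And>z. 0 \<le> H2 z"
    and e: "0 < norm e"
    and m: "0 \<le> m" "\<And>z. z \<in> ball ((1 / 2) *\<^sub>R e) (norm e / 8) \<Longrightarrow> d1 z + d2 (e - z) \<le> - m"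
  shows "(LINT z|lborel. d1 z / norm z ^ (CARD('n) + 1)) + (LINT z|lborel. d2 z / norm z ^ (CARD('n) + 1))
    \<le> (LINT z|lborel. H1 z / norm z ^ (CARD('n) + 1)) + (LINT z|lborel. H2 z / norm z ^ (CARD('n) + 1))
      - unit_ball_vol (real CARD('n)) / 8 ^ CARD('n) * (m / norm e)"
proof -
  let ?n = "CARD('n)" and ?\<rho> = "norm e"
  define D where "D = ball ((1 / 2) *\<^sub>R e) (?\<rho> / 8)"
  define k1 where "k1 z = (H1 z - d1 z) / norm z ^ (?n + 1)" for z
  define k2 where "k2 z = (H2 z - d2 z) / norm z ^ (?n + 1)" for z
  have k1: "has_bochner_integral lborel k1
      ((LINT z|lborel. H1 z / norm z ^ (?n + 1)) - (LINT z|lborel. d1 z / norm z ^ (?n + 1)))"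
    unfolding k1_def[abs_def] diff_divide_distrib
    by (intro has_bochner_integral_diff has_bochner_integral_integrable int)
  have k2: "has_bochner_integral lborel k2
      ((LINT z|lborel. H2 z / norm z ^ (?n + 1)) - (LINT z|lborel. d2 z / norm z ^ (?n + 1)))"
    unfolding k2_def[abs_def] diff_divide_distrib
    by (intro has_bochner_integral_diff has_bochner_integral_integrable int)
  have k_nonneg: "0 \<le> k1 z" "0 \<le> k2 z" for z
    using le by (auto simp: k1_def k2_def)
  have i1: "integrable lborel (\<lambda>z. indicator D z * k1 z)"
    using integrable_mult_indicator[of D lborel k1] k1 by (auto simp: D_def has_bochner_integral_iff)
  have i2: "integrable lborel (\<lambda>z. indicator D z * k2 z)"
    using integrable_mult_indicator[of D lborel k2] k2 by (auto simp: D_def has_bochner_integral_iff)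
  \<comment> \<open>D is centred at e/2, the fixed point of the reflection.\<close>
  have D_refl: "indicator D (e - z) = (indicator D z :: real)" for z
  proof -
    have "(1 / 2) *\<^sub>R e - (e - z) = - ((1 / 2) *\<^sub>R e - z)"
      by (simp add: algebra_simps flip: scaleR_left.add)
    then have "dist ((1 / 2) *\<^sub>R e) (e - z) = dist ((1 / 2) *\<^sub>R e) z"
      unfolding dist_norm by (metis norm_minus_cancel)
    then show ?thesis by (simp add: D_def indicator_def)
  qed
  have i2': "has_bochner_integral lborel (\<lambda>z. indicator D z * k2 (e - z)) (LINT z|lborel. indicator D z * k2 z)"
    using has_bochner_integral_lborel_affine[OF i2, of "-1" e] by (simp add: D_refl)
  \<comment> \<open>The radius |e|/8 keeps |z| and |e - z| between 3/8 and 5/8 of |e|, so both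
    kernels are at least |e|^-(n+1) on D.\<close>
  have D_norm: "norm z \<le> ?\<rho>" "norm (e - z) \<le> ?\<rho>" "0 < norm z" "0 < norm (e - z)" if "z \<in> D" for z
  proof -
    have *: "norm ((1 / 2) *\<^sub>R e - z) < ?\<rho> / 8" using that by (simp add: D_def dist_norm)
    have "z = (1 / 2) *\<^sub>R e - ((1 / 2) *\<^sub>R e - z)" by simp
    then have 1: "norm z \<le> ?\<rho> / 2 + ?\<rho> / 8" "?\<rho> / 2 - ?\<rho> / 8 < norm z"
      using * norm_triangle_ineq4[of "(1 / 2) *\<^sub>R e" "(1 / 2) *\<^sub>R e - z"]
        norm_triangle_ineq2[of "(1 / 2) *\<^sub>R e" "(1 / 2) *\<^sub>R e - z"] by auto
    have "e - z = (1 / 2) *\<^sub>R e + ((1 / 2) *\<^sub>R e - z)" by (simp add: algebra_simps flip: scaleR_left.add)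
    then have 2: "norm (e - z) \<le> ?\<rho> / 2 + ?\<rho> / 8" "?\<rho> / 2 - ?\<rho> / 8 < norm (e - z)"
      using * norm_triangle_ineq[of "(1 / 2) *\<^sub>R e" "(1 / 2) *\<^sub>R e - z"]
        norm_diff_ineq[of "(1 / 2) *\<^sub>R e" "(1 / 2) *\<^sub>R e - z"] by auto
    show "norm z \<le> ?\<rho>" "norm (e - z) \<le> ?\<rho>" "0 < norm z" "0 < norm (e - z)"
      using 1 2 e by linarith+
  qed
  \<comment> \<open>The deficits H - d are nonnegative everywhere; on D, paired by the reflection,
    they add up to at least m.\<close>
  have "(LINT z|lborel. indicator D z * (m / ?\<rho> ^ (?n + 1))) \<le>
      (LINT z|lborel. indicator D z * k1 z + indicator D z * k2 (e - z))"
  proof (rule integral_mono)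
    show "integrable lborel (\<lambda>z::real^'n. indicator D z * (m / ?\<rho> ^ (?n + 1)))"
      by (intro integrable_mult_left) (auto simp: D_def emeasure_ball)
    show "integrable lborel (\<lambda>z. indicator D z * k1 z + indicator D z * k2 (e - z))"
      using i1 i2' by (auto simp: has_bochner_integral_iff)
    fix z
    show "indicator D z * (m / ?\<rho> ^ (?n + 1)) \<le> indicator D z * k1 z + indicator D z * k2 (e - z)"
    proof (cases "z \<in> D")
      case True
      note zn = D_norm[OF True]
      have "m / ?\<rho> ^ (?n + 1) \<le> ((H1 z - d1 z) + (H2 (e - z) - d2 (e - z))) / ?\<rho> ^ (?n + 1)"
        using m(2)[of z] True nonneg(1)[of z] nonneg(2)[of "e - z"]
        by (intro divide_right_mono) (auto simp: D_def)
      also have "\<dots> \<le> k1 z + k2 (e - z)"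
        unfolding k1_def k2_def add_divide_distrib
        using zn le(1)[of z] le(2)[of "e - z"] by (intro add_mono frac_le power_mono zero_less_power) auto
      finally show ?thesis using True by simp
    qed simp
  qed
  also have "\<dots> = (LINT z|lborel. indicator D z * k1 z) + (LINT z|lborel. indicator D z * k2 z)"
    using i1 i2' by (simp add: has_bochner_integral_iff)
  also have "\<dots> \<le> (LINT z|lborel. k1 z) + (LINT z|lborel. k2 z)"
    using i1 i2 k1 k2 k_nonneg
    by (intro add_mono integral_mono) (auto simp: has_bochner_integral_iff indicator_def)
  also have "\<dots> = ((LINT z|lborel. H1 z / norm z ^ (?n + 1)) - (LINT z|lborel. d1 z / norm z ^ (?n + 1)))
     + ((LINT z|lborel. H2 z / norm z ^ (?n + 1)) - (LINT z|lborel. d2 z / norm z ^ (?n + 1)))"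
    using k1 k2 by (simp add: has_bochner_integral_iff)
  finally have *: "(LINT z|lborel. indicator D z * (m / ?\<rho> ^ (?n + 1))) \<le> \<dots>" .
  \<comment> \<open>The volume of D is proportional to (|e|/8)^n, which against |e|^-(n+1) leaves
    1/|e|.\<close>
  have "(LINT z|lborel. indicator D z * (m / ?\<rho> ^ (?n + 1))) = measure lborel D * (m / ?\<rho> ^ (?n + 1))"
    by (simp add: D_def)
  also have "\<dots> = unit_ball_vol (real ?n) / 8 ^ ?n * (m / ?\<rho>)"
    using e by (simp add: D_def content_ball power_divide)
  finally show ?thesis using * by linarith
qed

section \<open>Doubling of variables and regularity in space\<close>

lemma exists_small_multiplier:
  assumes "0 < (\<delta>::real)" "0 \<le> Y"
  shows "\<exists>\<kappa>>0. \<kappa> * Y \<le> \<delta>"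
  using assms by (intro exI[of _ "\<delta> / (Y + 1)"]) (auto simp: field_simps)

text \<open>The Hoelder exponent is 2\<beta>. \<gamma> is half the coupling mass, because the gain m
  is half of L \<rho>^(2\<beta>). In units of X = L \<rho>^(2\<beta> - 1) the coupling gains lam
  \<gamma>/2, and the smallness of \<beta> lets drift and positive parts use up at most half of
  that. What remains, lam \<gamma>/4 X, is at most 6 N/T by the penalisations, against which the 25
  in C is chosen; the 3 makes the modulus exceed 2 N at distances above T.\<close>

lemma spatial_holder_estimate:
  fixes u :: "(real^'n) \<times> real \<Rightarrow> real"
  defines "\<gamma> \<equiv> unit_ball_vol (real CARD('n)) / (2 * 8 ^ CARD('n))"
  assumes par: "0 \<le> A" "0 < lam" "lam \<le> Lam"
    and \<beta>: "0 < \<beta>" "\<beta> \<le> 1 / 4" "\<beta> * (4 * A + 8 * Lam * qgrowth_mass TYPE('n)) \<le> lam * \<gamma> / 4"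
    and C: "C = 25 / (lam * \<gamma>) + 3"
    and touch: "quad_test_ineq A lam Lam T u" "quad_test_ineq A lam Lam T (\<lambda>p. - u p)"
    and cont: "continuous_on (UNIV \<times> {0..T}) u"
    and bdd: "\<And>x t. t \<in> {0..T} \<Longrightarrow> \<bar>u (x, t)\<bar> \<le> N"
    and T: "0 < T" and N: "0 < N"
  shows "u (x0, T) - u (y0, T) \<le> C * N / T powr (2 * \<beta>) * norm (x0 - y0) powr (2 * \<beta>)"
proof (rule ccontr)
  let ?G = "qgrowth_mass TYPE('n)"
  \<comment> \<open>Growth of order |x|^(1/2): coercive, and still integrable against the kernel at
    infinity.\<close>
  let ?\<psi> = "soft_power (1 / 4) 1 :: real^'n \<Rightarrow> real"
  have \<gamma>: "0 < \<gamma>" by (simp add: \<gamma>_def)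
  have C3: "3 < C" using par \<gamma> by (simp add: C)
  define L where "L = C * N / T powr (2 * \<beta>)"
  have L: "0 < L" using C3 N T by (simp add: L_def)
  define g where "g = u (x0, T) - u (y0, T) - L * soft_power \<beta> 0 (x0 - y0)"
  assume "\<not> ?thesis"
  then have g: "0 < g" by (simp add: g_def L_def soft_power_0)
  \<comment> \<open>Bounds the increase of the penalisation under a shift of length at most T:
    gradient at most 1/2, quadratic coefficient at most 1/4.\<close>
  define Q where "Q = T / 2 + T\<^sup>2 / 4"
  \<comment> \<open>Collects what \<kappa> must make small: the penalisation at x0, its increase
    under coupling shifts, and its contribution to the equation.\<close>
  define Y where "Y = ?\<psi> x0 + Q + A + Lam * ?G"
  have nn: "0 \<le> ?\<psi> x0" "0 \<le> Q" "0 \<le> Lam * ?G"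
    using T par qgrowth_mass_nonneg[where 'n = 'n] by (auto simp: Q_def)
  obtain \<kappa> where \<kappa>: "0 < \<kappa>" "\<kappa> * Y \<le> min (g / 8) (N / T)"
    using exists_small_multiplier[of "min (g / 8) (N / T)" Y] nn par g N T by (auto simp: Y_def)
  have \<kappa>_le: "\<kappa> * ?\<psi> x0 \<le> g / 8" "\<kappa> * Q \<le> g / 8" "\<kappa> * (A + Lam * ?G) \<le> N / T"
  proof -
    have "\<kappa> * ?\<psi> x0 \<le> \<kappa> * Y" "\<kappa> * Q \<le> \<kappa> * Y" "\<kappa> * (A + Lam * ?G) \<le> \<kappa> * Y"
      using \<kappa> nn par by (auto intro!: mult_left_mono simp: Y_def)
    then show "\<kappa> * ?\<psi> x0 \<le> g / 8" "\<kappa> * Q \<le> g / 8" "\<kappa> * (A + Lam * ?G) \<le> N / T"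
      using \<kappa>(2) by auto
  qed
  obtain R where R: "0 < R" "\<And>p::real^'n. R \<le> norm p \<Longrightarrow> 2 * N / \<kappa> \<le> ?\<psi> p"
    using soft_power_coercive[of "1 / 4"] by (metis zero_less_divide_1_iff zero_less_numeral)
  \<comment> \<open>For |x| \<ge> R the penalisation is at least 2 N, and for |x - y| > T the
    modulus is; hence the radii R and R + T.\<close>
  define S where "S = (cball (0::real^'n) R \<times> {0..T}) \<times> (cball (0::real^'n) (R + T) \<times> {0..T})"
  have "uniformly_continuous_on (cball 0 (R + T) \<times> {0..T}) u"
    by (intro compact_uniformly_continuous continuous_on_subset[OF cont] compact_Times compact_cball compact_Icc) auto
  then obtain \<delta> where \<delta>: "0 < \<delta>"
    and uc: "\<And>p q. \<lbrakk>p \<in> cball 0 (R + T) \<times> {0..T}; q \<in> cball 0 (R + T) \<times> {0..T}; dist p q < \<delta>\<rbrakk> \<Longrightarrow> dist (u p) (u q) < g / 4"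
    unfolding uniformly_continuous_on_def using g by (metis dist_commute divide_pos_pos zero_less_numeral)
  have time_uc: "\<bar>u (z, t) - u (z, s)\<bar> < g / 4"
    if "norm z \<le> R + T" "t \<in> {0..T}" "s \<in> {0..T}" "\<bar>t - s\<bar> < \<delta>" for z t s
    using uc[of "(z, t)" "(z, s)"] that by (simp add: dist_Pair_Pair dist_real_def)
  \<comment> \<open>\<delta> makes time increments of u smaller than g/4; T/4 keeps s positive once
    t > T/2.\<close>
  define \<mu> where "\<mu> = min \<delta> (T / 4)"
  have \<mu>: "0 < \<mu>" "\<mu> \<le> \<delta>" "\<mu> \<le> T / 4" using \<delta> T by (auto simp: \<mu>_def)
  \<comment> \<open>Chosen so that (t - s)^2 / \<epsilon> < 2 N gives (t - s)^2 < \<mu>^2 /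
    2.\<close>
  define \<epsilon> where "\<epsilon> = \<mu>\<^sup>2 / (4 * N)"
  have \<epsilon>: "0 < \<epsilon>" using \<mu> N by (simp add: \<epsilon>_def)
  \<comment> \<open>The last term vanishes at t = T and is at least 2 N for t \<le> T/2, which keeps
    the maximum away from time 0. A maximum at t = T is admissible, since contact is tested only in
    the past.\<close>
  define \<Phi> where "\<Phi> x t y s = u (x, t) - u (y, s) - L * soft_power \<beta> 0 (x - y) - \<kappa> * ?\<psi> x
      - (t - s)\<^sup>2 / \<epsilon> - 4 * N * (1 - t / T)" for x t y s
  have u2N: "u (x, t) - u (y, s) \<le> 2 * N" if "t \<in> {0..T}" "s \<in> {0..T}" for x y t s
    using bdd[OF that(1), of x] bdd[OF that(2), of y] by linarith
  have far: "2 * N < L * soft_power \<beta> 0 (x - y)" if "T < norm (x - y)" for x y :: "real^'n"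
  proof -
    have "2 * N < C * N" using C3 N by simp
    also have "C * N = L * T powr (2 * \<beta>)" using T by (simp add: L_def)
    also have "\<dots> \<le> L * soft_power \<beta> 0 (x - y)"
      unfolding soft_power_0 using that T L \<beta> by (intro mult_left_mono powr_mono2) auto
    finally show ?thesis .
  qed
  have pen: "0 \<le> L * soft_power \<beta> 0 (x - y)" "0 \<le> \<kappa> * ?\<psi> x" "0 \<le> (t - s)\<^sup>2 / \<epsilon>" for x y t s
    using L \<kappa> \<epsilon> by auto
  have pen_t: "0 \<le> 4 * N * (1 - t / T)" if "t \<in> {0..T}" for t
    using that N T by auto
  have outside: "\<Phi> x t y s \<le> 0" if ts: "t \<in> {0..T}" "s \<in> {0..T}" and "((x, t), (y, s)) \<notin> S" for x t y s
  proof -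
    from that have "R \<le> norm x \<or> (norm x \<le> R \<and> R + T < norm y)" by (auto simp: S_def)
    then have "2 * N \<le> \<kappa> * ?\<psi> x \<or> 2 * N \<le> L * soft_power \<beta> 0 (x - y)"
    proof
      assume "R \<le> norm x"
      from R(2)[OF this] show ?thesis using \<kappa> by (simp add: divide_le_eq mult.commute)
    next
      assume "norm x \<le> R \<and> R + T < norm y"
      then have "T < norm (x - y)" using norm_triangle_ineq2[of y x] by (simp add: norm_minus_commute)
      from far[OF this] show ?thesis by simp
    qed
    then show ?thesis
      using u2N[OF ts, of x y] pen(1)[of x y] pen(2)[of x] pen(3)[of t s] pen_t[OF ts(1)] unfolding \<Phi>_def by linarith
  qed
  have \<Phi>0: "g / 2 < \<Phi> x0 T y0 T"
    using \<kappa>_le(1) g T unfolding \<Phi>_def g_def by simp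
  have in_S: "((x0, T), (y0, T)) \<in> S"
    using outside[of T T x0 y0] \<Phi>0 g T by fastforce
  define F where "F = (\<lambda>((x, t), (y, s)). \<Phi> x t y s)"
  have F_eq [simp]: "F ((x, t), (y, s)) = \<Phi> x t y s" for x t y s by (simp add: F_def)
  have comp: "compact S" unfolding S_def by (intro compact_Times compact_cball compact_Icc)
  have contF: "continuous_on S F"
  proof -
    have "continuous_on S (\<lambda>p. \<Phi> (fst (fst p)) (snd (fst p)) (fst (snd p)) (snd (snd p)))"
      unfolding \<Phi>_def
      by (intro continuous_intros continuous_on_compose2[OF cont]) (use T \<beta> \<epsilon> in \<open>auto simp: S_def\<close>)
    then show ?thesis by (simp add: F_def case_prod_beta')
  qed
  have ne: "S \<noteq> {}" using in_S by blast
  obtain q where q: "q \<in> S" "\<And>p. p \<in> S \<Longrightarrow> F p \<le> F q"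
    using continuous_attains_sup[OF comp ne contF] by blast
  obtain x t y s where qeq: "q = ((x, t), (y, s))" by (metis surj_pair)
  have ts: "t \<in> {0..T}" "s \<in> {0..T}" and xR: "norm x \<le> R" and yR: "norm y \<le> R + T"
    using q(1) by (auto simp: qeq S_def)
  have \<Phi>pos: "g / 2 < \<Phi> x t y s" using q(2)[OF in_S] \<Phi>0 by (simp add: qeq)
  have max: "\<Phi> x' t' y' s' \<le> \<Phi> x t y s" if "t' \<in> {0..T}" "s' \<in> {0..T}" for x' t' y' s'
  proof (cases "((x', t'), (y', s')) \<in> S")
    case True from q(2)[OF this] show ?thesis by (simp add: qeq)
  next
    case False
    from outside[OF that this] \<Phi>pos g show ?thesis by linarith
  qed
  define \<rho> where "\<rho> = norm (x - y)"
  define J where "J = u (x, t) - u (y, s)"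
  have J: "L * \<rho> powr (2 * \<beta>) + g / 2 < J"
    "(t - s)\<^sup>2 / \<epsilon> < 2 * N" "4 * N * (1 - t / T) < 2 * N" "L * soft_power \<beta> 0 (x - y) \<le> 2 * N"
    using \<Phi>pos u2N[OF ts, of x y] pen(1)[of x y] pen(2)[of x] pen(3)[of t s] pen_t[OF ts(1)] g
    unfolding \<Phi>_def J_def \<rho>_def soft_power_0 by linarith+
  have "(t - s)\<^sup>2 < 2 * N * \<epsilon>" using J(2) \<epsilon> by (simp add: divide_less_eq)
  also have "2 * N * \<epsilon> = \<mu>\<^sup>2 / 2" using N by (simp add: \<epsilon>_def)
  also have "\<dots> < \<mu>\<^sup>2" using \<mu> by simp
  finally have ts_close: "\<bar>t - s\<bar> < \<mu>" using \<mu> power2_less_imp_less[of "\<bar>t - s\<bar>" \<mu>] by simp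
  have "T / 2 < t" using J(3) N T by (simp add: field_simps)
  then have t0: "0 < t" and s0: "0 < s" using ts_close \<mu> T by linarith+
  have \<rho>T: "\<rho> \<le> T" using far[of x y] J(4) unfolding \<rho>_def by linarith
  \<comment> \<open>For x = y the gap J would be a mere time increment, below g/4, whereas J > g/2.
    Away from 0 the modulus has quadratic majorants.\<close>
  have \<rho>: "0 < \<rho>"
  proof (rule ccontr)
    assume "\<not> 0 < \<rho>"
    then have "x = y" by (simp add: \<rho>_def)
    moreover have "\<bar>u (x, t) - u (x, s)\<bar> < g / 4"
      using xR T ts ts_close \<mu> by (intro time_uc) auto
    ultimately have "J < g / 4" unfolding J_def by (metis abs_ge_self le_less_trans)
    moreover have "0 \<le> L * \<rho> powr (2 * \<beta>)" using L by simp
    ultimately show False using J(1) g by linarith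
  qed
  define X where "X = L * \<rho> powr (2 * \<beta> - 1)"
  have X: "0 < X" using L \<rho> by (simp add: X_def)
  have X\<rho>: "L * \<rho> powr (2 * \<beta>) / \<rho> = X" using \<rho> by (simp add: X_def powr_diff)
  \<comment> \<open>The exponent 2\<beta> - 1 is negative and \<rho> \<le> T.\<close>
  have X_ge: "C * N / T \<le> X"
  proof -
    have "C * N / T = L * T powr (2 * \<beta> - 1)" using T by (simp add: L_def powr_diff)
    also have "\<dots> \<le> X" unfolding X_def using \<rho> \<rho>T L \<beta> by (intro mult_left_mono powr_mono2') auto
    finally show ?thesis .
  qed
  define B1 where "B1 = \<beta> * ((norm (x - y))\<^sup>2 + 0\<^sup>2) powr (\<beta> - 1)"
  define B2 where "B2 = 1 / 4 * ((norm x)\<^sup>2 + 1\<^sup>2) powr (1 / 4 - 1)"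
  have P1: "\<rho>\<^sup>2 \<le> (norm (x - y))\<^sup>2 + 0\<^sup>2" "0 < (norm (x - y))\<^sup>2 + (0::real)\<^sup>2"
    using \<rho> by (auto simp: \<rho>_def)
  have P2: "1\<^sup>2 \<le> (norm x)\<^sup>2 + (1::real)\<^sup>2" "0 < (norm x)\<^sup>2 + (1::real)\<^sup>2"
    by (auto simp: add_nonneg_pos)
  have quad1: "L * soft_power \<beta> 0 (x - y + z) \<le> L * (soft_power \<beta> 0 (x - y) + B1 * (2 * ((x - y) \<bullet> z) + (norm z)\<^sup>2))" for z
    unfolding B1_def using L P1 \<beta> by (intro mult_left_mono soft_power_le_quadratic) auto
  have quad2: "\<kappa> * ?\<psi> (x + z) \<le> \<kappa> * (?\<psi> x + B2 * (2 * (x \<bullet> z) + (norm z)\<^sup>2))" for z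
    unfolding B2_def using \<kappa> P2 by (intro mult_left_mono soft_power_le_quadratic) auto
  have grad1: "norm ((2 * B1) *\<^sub>R (x - y)) \<le> 2 * \<beta> * \<rho> powr (2 * \<beta> - 1)"
    unfolding B1_def using \<rho> P1 \<beta> by (intro soft_power_gradient_le) auto
  have grad2: "norm ((2 * B2) *\<^sub>R x) \<le> 1 / 2"
    using soft_power_gradient_le[of 1 x 1 "1 / 4"] P2 unfolding B2_def by simp
  have B2: "0 \<le> B2" "B2 \<le> 1 / 4"
    using powr_mono2'[of "- (3 / 4)" 1 "(norm x)\<^sup>2 + 1"] by (auto simp: B2_def)
  \<comment> \<open>Gradients of the test functions for u in x and for -u in y; the penalisation
    depends on x alone and enters only b1.\<close>
  define b1 where "b1 = L *\<^sub>R ((2 * B1) *\<^sub>R (x - y)) + \<kappa> *\<^sub>R ((2 * B2) *\<^sub>R x)"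
  define b2 where "b2 = L *\<^sub>R ((2 * B1) *\<^sub>R (y - x))"
  have norm_b2: "norm b2 \<le> 2 * \<beta> * X"
  proof -
    have "norm b2 = L * norm ((2 * B1) *\<^sub>R (x - y))"
      using L unfolding b2_def by (simp add: norm_minus_commute abs_mult)
    also have "\<dots> \<le> L * (2 * \<beta> * \<rho> powr (2 * \<beta> - 1))" using grad1 L by (intro mult_left_mono) auto
    finally show ?thesis by (simp add: X_def mult_ac)
  qed
  have norm_b1: "norm b1 \<le> 2 * \<beta> * X + \<kappa> / 2"
  proof -
    have "norm b1 \<le> norm (L *\<^sub>R ((2 * B1) *\<^sub>R (x - y))) + norm (\<kappa> *\<^sub>R ((2 * B2) *\<^sub>R x))"
      unfolding b1_def by (rule norm_triangle_ineq)
    also have "\<dots> = norm b2 + \<kappa> * norm ((2 * B2) *\<^sub>R x)"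
      using \<kappa> unfolding b2_def by (simp add: norm_minus_commute abs_mult)
    also have "\<dots> \<le> 2 * \<beta> * X + \<kappa> * (1 / 2)"
      using norm_b2 grad2 \<kappa> by (intro add_mono mult_left_mono) auto
    finally show ?thesis by simp
  qed
  \<comment> \<open>\<rho>/4 keeps the polynomial branch off the coupling ball, 1 serves
    integrability, and the last entry limits the loss from time curvature to N/T.\<close>
  define r where "r = min (min (\<rho> / 4) 1) (\<epsilon> * N / (2 * T))"
  have r: "0 < r" "r \<le> 1" "r \<le> \<rho> / 4" "2 * r / \<epsilon> \<le> N / T"
  proof -
    show "0 < r" "r \<le> 1" "r \<le> \<rho> / 4" using \<rho> \<epsilon> N T by (auto simp: r_def)
    have "r \<le> \<epsilon> * N / (2 * T)" by (simp add: r_def)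
    then show "2 * r / \<epsilon> \<le> N / T" using \<epsilon> T by (simp add: field_simps)
  qed
  \<comment> \<open>In the past window the squared time increment lies below a linear function, so
    the curvature in time is absorbed into the slopes c1 and c2.\<close>
  have square_le: "(\<tau> - t')\<^sup>2 \<le> - r * (\<tau> - t')" if "t' - r < \<tau>" "\<tau> \<le> t'" for \<tau> t'
  proof -
    have "(t' - \<tau>) * (t' - \<tau>) \<le> r * (t' - \<tau>)" using that by (intro mult_right_mono) auto
    then show ?thesis by (simp add: power2_eq_square algebra_simps)
  qed
  \<comment> \<open>Slopes of the time penalisations. The terms with t - s cancel in c1 + c2; each
    -r/\<epsilon> comes from \<open>square_le\<close>.\<close>
  define c1 where "c1 = 2 * (t - s) / \<epsilon> - r / \<epsilon> - 4 * N / T"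
  define c2 where "c2 = - 2 * (t - s) / \<epsilon> - r / \<epsilon>"
  define M1 where "M1 = L * B1 + \<kappa> * B2"
  define M2 where "M2 = L * B1"
  define d1 where "d1 z = (if norm z < r then 2 * M1 * (norm z)\<^sup>2 else second_diff (\<lambda>z. u (z, t)) x z)" for z
  define d2 where "d2 z = (if norm z < r then 2 * M2 * (norm z)\<^sup>2 else second_diff (\<lambda>z. - u (z, s)) y z)" for z
  have ineq1: "c1 - A * norm b1 \<le> 1 / 2 * (LINT z|lborel. extremal lam Lam (d1 z) / norm z ^ (CARD('n) + 1))"
    unfolding d1_def
  proof (rule quad_test_ineqD[OF touch(1)])
    fix z :: "real^'n" and \<tau> assume *: "norm z < r" "t - r < \<tau>" "\<tau> \<le> t" "0 \<le> \<tau>"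
    have "\<Phi> (x + z) \<tau> y s \<le> \<Phi> x t y s" using * ts by (intro max) auto
    moreover have "x + z - y = x - y + z" by simp
    moreover have "(\<tau> - s)\<^sup>2 / \<epsilon> \<le> (t - s)\<^sup>2 / \<epsilon> + (2 * (t - s) / \<epsilon> - r / \<epsilon>) * (\<tau> - t)"
    proof -
      have "(\<tau> - s)\<^sup>2 = (t - s)\<^sup>2 + 2 * (t - s) * (\<tau> - t) + (\<tau> - t)\<^sup>2"
        by (simp add: power2_eq_square algebra_simps)
      also have "\<dots> \<le> (t - s)\<^sup>2 + (2 * (t - s) - r) * (\<tau> - t)"
        using square_le[OF *(2,3)] by (simp add: algebra_simps)
      finally have "(\<tau> - s)\<^sup>2 / \<epsilon> \<le> ((t - s)\<^sup>2 + (2 * (t - s) - r) * (\<tau> - t)) / \<epsilon>"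
        using \<epsilon> by (intro divide_right_mono) auto
      also have "\<dots> = (t - s)\<^sup>2 / \<epsilon> + (2 * (t - s) / \<epsilon> - r / \<epsilon>) * (\<tau> - t)"
        using \<epsilon> by (simp add: field_simps)
      finally show ?thesis .
    qed
    moreover have "4 * N * (1 - \<tau> / T) = 4 * N * (1 - t / T) + (- 4 * N / T) * (\<tau> - t)"
      by (simp add: algebra_simps diff_divide_distrib)
    moreover have "b1 \<bullet> z + M1 * (norm z)\<^sup>2 = L * (B1 * (2 * ((x - y) \<bullet> z) + (norm z)\<^sup>2))
        + \<kappa> * (B2 * (2 * (x \<bullet> z) + (norm z)\<^sup>2))"
      by (simp add: b1_def M1_def inner_add_left distrib_left distrib_right mult_ac)
    moreover have "c1 * (\<tau> - t) = (2 * (t - s) / \<epsilon> - r / \<epsilon>) * (\<tau> - t) + (- 4 * N / T) * (\<tau> - t)"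
      unfolding c1_def by (simp add: left_diff_distrib)
    ultimately show "u (x + z, \<tau>) \<le> u (x, t) + b1 \<bullet> z + M1 * (norm z)\<^sup>2 + c1 * (\<tau> - t)"
      using quad1[of z] quad2[of z] unfolding \<Phi>_def distrib_left[of L] distrib_left[of \<kappa>] by (simp only:)
  qed (use t0 ts r in auto)
  have ineq2: "c2 - A * norm b2 \<le> 1 / 2 * (LINT z|lborel. extremal lam Lam (d2 z) / norm z ^ (CARD('n) + 1))"
    unfolding d2_def
  proof (rule quad_test_ineqD[OF touch(2)])
    fix z :: "real^'n" and \<tau> assume *: "norm z < r" "s - r < \<tau>" "\<tau> \<le> s" "0 \<le> \<tau>"
    have "\<Phi> x t (y + z) \<tau> \<le> \<Phi> x t y s" using * ts by (intro max) auto
    moreover have "x - (y + z) = x - y + (- z)" by simp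
    moreover have "(t - \<tau>)\<^sup>2 / \<epsilon> \<le> (t - s)\<^sup>2 / \<epsilon> + c2 * (\<tau> - s)"
    proof -
      have "(t - \<tau>)\<^sup>2 = (t - s)\<^sup>2 - 2 * (t - s) * (\<tau> - s) + (\<tau> - s)\<^sup>2"
        by (simp add: power2_eq_square algebra_simps)
      also have "\<dots> \<le> (t - s)\<^sup>2 + (- 2 * (t - s) - r) * (\<tau> - s)"
        using square_le[OF *(2,3)] by (simp add: algebra_simps)
      finally have "(t - \<tau>)\<^sup>2 / \<epsilon> \<le> ((t - s)\<^sup>2 + (- 2 * (t - s) - r) * (\<tau> - s)) / \<epsilon>"
        using \<epsilon> by (intro divide_right_mono) auto
      also have "\<dots> = (t - s)\<^sup>2 / \<epsilon> + c2 * (\<tau> - s)"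
        using \<epsilon> by (simp add: c2_def field_simps)
      finally show ?thesis .
    qed
    moreover have "b2 \<bullet> z + M2 * (norm z)\<^sup>2 = L * (B1 * (2 * ((x - y) \<bullet> (- z)) + (norm (- z))\<^sup>2))"
      by (simp add: b2_def M2_def inner_diff_left right_diff_distrib distrib_left mult_ac)
    ultimately show "- u (y + z, \<tau>) \<le> - u (y, s) + b2 \<bullet> z + M2 * (norm z)\<^sup>2 + c2 * (\<tau> - s)"
      using quad1[of "- z"] unfolding \<Phi>_def distrib_left[of L] by (simp only:)
  qed (use s0 ts r in auto)
  define H2 where "H2 z = L * (8 * \<beta> * \<rho> powr (2 * \<beta>) * qgrowth (norm z / \<rho>))" for z :: "real^'n"
  \<comment> \<open>The added term is the majorant for the penalisation: 2 is 8\<beta> at \<beta> =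
    1/4, and the division by 1 exhibits the dilated kernel with \<theta> = 1.\<close>
  define H1 where "H1 z = H2 z + \<kappa> * (2 * qgrowth (norm z / 1))" for z :: "real^'n"
  have H_nonneg: "0 \<le> H2 z" "0 \<le> H1 z" for z
    using L \<kappa> \<beta> \<rho> by (auto simp: H1_def H2_def)
  have sd1: "L * (soft_power \<beta> 0 (x - y + z) + soft_power \<beta> 0 (x - y - z) - 2 * soft_power \<beta> 0 (x - y)) \<le> H2 z" for z
    unfolding H2_def using L \<rho> P1 \<beta> by (intro mult_left_mono soft_power_second_diff_le) auto
  have sd2: "\<kappa> * (?\<psi> (x + z) + ?\<psi> (x - z) - 2 * ?\<psi> x) \<le> \<kappa> * (2 * qgrowth (norm z / 1))" for z
    using \<kappa> soft_power_second_diff_le[of 1 x 1 "1 / 4" z] P2 by (intro mult_left_mono) auto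
  have qd1: "2 * M2 * (norm z)\<^sup>2 \<le> H2 z" if "norm z < r" for z
  proof -
    have "L * (2 * B1 * (norm z)\<^sup>2) \<le> H2 z"
      unfolding H2_def B1_def using L \<rho> P1 \<beta> that r by (intro mult_left_mono soft_power_quadratic_le_qgrowth) auto
    then show ?thesis by (simp add: M2_def mult_ac)
  qed
  have d2_le: "d2 z \<le> H2 z" for z
  proof (cases "norm z < r")
    case False
    have "\<Phi> x t (y + z) s \<le> \<Phi> x t y s" "\<Phi> x t (y - z) s \<le> \<Phi> x t y s" using ts by (auto intro!: max)
    then have "second_diff (\<lambda>z. - u (z, s)) y z \<le>
        L * (soft_power \<beta> 0 (x - y + z) + soft_power \<beta> 0 (x - y - z) - 2 * soft_power \<beta> 0 (x - y))"
      by (simp add: \<Phi>_def second_diff_def algebra_simps)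
    also have "\<dots> \<le> H2 z" by (rule sd1)
    finally show ?thesis using False by (simp add: d2_def)
  qed (use qd1 in \<open>auto simp: d2_def\<close>)
  have d1_le: "d1 z \<le> H1 z" for z
  proof (cases "norm z < r")
    case True
    have "2 * B2 * (norm z)\<^sup>2 \<le> 2 * qgrowth (norm z / 1)"
    proof -
      have "2 * B2 * (norm z)\<^sup>2 \<le> 2 * (norm z)\<^sup>2" using B2 by (intro mult_right_mono) auto
      then show ?thesis using True r by (simp add: qgrowth_eq_square)
    qed
    then have "\<kappa> * (2 * B2 * (norm z)\<^sup>2) \<le> \<kappa> * (2 * qgrowth (norm z / 1))"
      using \<kappa> by (intro mult_left_mono) auto
    then show ?thesis
      using True qd1[OF True] by (simp add: d1_def H1_def M1_def M2_def algebra_simps)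
  next
    case False
    have "\<Phi> (x + z) t y s \<le> \<Phi> x t y s" "\<Phi> (x - z) t y s \<le> \<Phi> x t y s" using ts by (auto intro!: max)
    moreover have "x + z - y = x - y + z" "x - z - y = x - y - z" by auto
    ultimately have "second_diff (\<lambda>z. u (z, t)) x z \<le>
        L * (soft_power \<beta> 0 (x - y + z) + soft_power \<beta> 0 (x - y - z) - 2 * soft_power \<beta> 0 (x - y))
        + \<kappa> * (?\<psi> (x + z) + ?\<psi> (x - z) - 2 * ?\<psi> x)"
      unfolding \<Phi>_def second_diff_def right_diff_distrib[of L] right_diff_distrib[of \<kappa>]
        distrib_left[of L] distrib_left[of \<kappa>] mult.left_commute[of _ 2] by (simp only:)
    also have "\<dots> \<le> H1 z" unfolding H1_def by (intro add_mono sd1 sd2)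
    finally show ?thesis using False by (simp add: d1_def)
  qed
  have h2: "has_bochner_integral lborel (\<lambda>z. H2 z / norm z ^ (CARD('n) + 1)) (8 * \<beta> * X * ?G)"
    using has_bochner_integral_mult_right[OF has_bochner_integral_qgrowth_scaled[OF \<rho>, where 'n = 'n],
        of "L * (8 * \<beta> * \<rho> powr (2 * \<beta>))"]
    by (simp add: H2_def X\<rho>[symmetric] mult_ac)
  have h1: "has_bochner_integral lborel (\<lambda>z. H1 z / norm z ^ (CARD('n) + 1)) (8 * \<beta> * X * ?G + 2 * \<kappa> * ?G)"
    using has_bochner_integral_add[OF h2 has_bochner_integral_mult_right[OF
        has_bochner_integral_qgrowth_scaled[OF zero_less_one, where 'n = 'n], of "2 * \<kappa>"]]
    by (simp add: H1_def add_divide_distrib mult_ac)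
  have cu: "continuous_on UNIV (\<lambda>z. u (z, t))" "continuous_on UNIV (\<lambda>z. - u (z, s))"
    using ts by (auto intro!: continuous_intros continuous_on_compose2[OF cont])
  have bu: "\<bar>u (z, t)\<bar> \<le> N" "\<bar>- u (z, s)\<bar> \<le> N" for z using bdd ts by auto
  have Hi: "integrable lborel (\<lambda>z. H1 z / norm z ^ (CARD('n) + 1))"
      "integrable lborel (\<lambda>z. H2 z / norm z ^ (CARD('n) + 1))"
    using h1 h2 by (auto simp: has_bochner_integral_iff)
  note I1 = touched_integral_le[OF par(2,3) cu(1) bu(1) r(1,2) Hi(1) H_nonneg(2) d1_le[unfolded d1_def], folded d1_def]
  note I2 = touched_integral_le[OF par(2,3) cu(2) bu(2) r(1,2) Hi(2) H_nonneg(1) d2_le[unfolded d2_def], folded d2_def]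
  \<comment> \<open>Half the modulus: doubling x - y multiplies it by 2^(2\<beta>) \<le> 3/2, so a
    pair at distance 2\<rho> exceeds J by at most half of it, up to errors in g. Against -2J, with J
    above the full modulus, this leaves -m.\<close>
  define m where "m = L * \<rho> powr (2 * \<beta>) / 2"
  have m0: "0 \<le> m" using L by (simp add: m_def)
  have coupled: "d1 z + d2 (y - x - z) \<le> - m" if "z \<in> ball ((1 / 2) *\<^sub>R (y - x)) (norm (y - x) / 8)" for z
  proof -
    define e where "e = y - x"
    have ne: "norm e = \<rho>" by (simp add: e_def \<rho>_def norm_minus_commute)
    have *: "norm ((1 / 2) *\<^sub>R e - z) < \<rho> / 8" using that ne by (simp add: dist_norm e_def)
    have "z = (1 / 2) *\<^sub>R e - ((1 / 2) *\<^sub>R e - z)" by simp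
    then have 1: "norm z \<le> \<rho>" "\<rho> / 4 < norm z"
      using * ne \<rho> norm_triangle_ineq4[of "(1 / 2) *\<^sub>R e" "(1 / 2) *\<^sub>R e - z"]
        norm_triangle_ineq2[of "(1 / 2) *\<^sub>R e" "(1 / 2) *\<^sub>R e - z"] by auto
    have "e - z = (1 / 2) *\<^sub>R e + ((1 / 2) *\<^sub>R e - z)" by (simp add: algebra_simps flip: scaleR_left.add)
    then have 2: "\<rho> / 4 < norm (e - z)"
      using * ne \<rho> norm_diff_ineq[of "(1 / 2) *\<^sub>R e" "(1 / 2) *\<^sub>R e - z"] by auto
    \<comment> \<open>The jumps z from x and -(e - z) from y land at the same point x + z, leaving a
      time increment; the opposite jumps land at points that differ by 2(x - y). The errors g/4 and
      g/8 are covered by the g/2 in \<open>J\<close>.\<close>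
    have "d1 z + d2 (e - z) = (u (x + z, t) - u (x + z, s)) + (u (x - z, t) - u (y + (e - z), s)) - 2 * J"
      using 1 2 r unfolding d1_def d2_def by (auto simp: second_diff_def J_def e_def)
    moreover have "u (x + z, t) - u (x + z, s) < g / 4"
    proof -
      have "norm (x + z) \<le> R + T" using norm_triangle_ineq[of x z] xR 1 \<rho>T by linarith
      then have "\<bar>u (x + z, t) - u (x + z, s)\<bar> < g / 4"
        using ts ts_close \<mu> by (intro time_uc) auto
      then show ?thesis by (metis abs_ge_self le_less_trans)
    qed
    moreover have "u (x - z, t) - u (y + (e - z), s) \<le> J + L * \<rho> powr (2 * \<beta>) / 2 + g / 8"
    proof -
      have "\<Phi> (x - z) t (y + (e - z)) s \<le> \<Phi> x t y s" using ts by (intro max) auto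
      moreover have "L * soft_power \<beta> 0 (x - z - (y + (e - z))) \<le> 3 / 2 * (L * \<rho> powr (2 * \<beta>))"
      proof -
        have "(2::real) powr (2 * \<beta>) \<le> 2 powr (1 / 2)" using \<beta> by (intro powr_mono) auto
        also have "\<dots> \<le> 3 / 2" unfolding powr_half_sqrt[OF zero_le_numeral]
          by (rule real_le_lsqrt) (auto simp: power2_eq_square)
        finally have "2 powr (2 * \<beta>) * (L * \<rho> powr (2 * \<beta>)) \<le> 3 / 2 * (L * \<rho> powr (2 * \<beta>))"
          using L by (intro mult_right_mono) auto
        moreover have "x - z - (y + (e - z)) = 2 *\<^sub>R (x - y)" by (simp add: e_def scaleR_2)
        ultimately show ?thesis by (simp add: soft_power_0 powr_mult \<rho>_def mult_ac)
      qed
      moreover have "L * soft_power \<beta> 0 (x - y) = L * \<rho> powr (2 * \<beta>)" by (simp add: soft_power_0 \<rho>_def)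
      moreover have "\<kappa> * ?\<psi> (x - z) \<le> \<kappa> * ?\<psi> x + g / 8"
      proof -
        have "((2 * B2) *\<^sub>R x) \<bullet> (- z) \<le> norm ((2 * B2) *\<^sub>R x) * norm (- z)"
          by (rule norm_cauchy_schwarz)
        also have "\<dots> \<le> 1 / 2 * T"
          using grad2 1 \<rho>T by (intro mult_mono) auto
        finally have "B2 * (2 * (x \<bullet> (- z))) \<le> T / 2" by (simp add: mult_ac)
        moreover have "B2 * (norm (- z))\<^sup>2 \<le> 1 / 4 * T\<^sup>2"
          using B2 1 \<rho>T by (intro mult_mono power_mono) auto
        ultimately have "B2 * (2 * (x \<bullet> (- z)) + (norm (- z))\<^sup>2) \<le> Q"
          unfolding Q_def distrib_left by linarith
        then have "\<kappa> * (B2 * (2 * (x \<bullet> (- z)) + (norm (- z))\<^sup>2)) \<le> \<kappa> * Q"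
          using \<kappa> by (intro mult_left_mono) auto
        then show ?thesis
          using quad2[of "- z"] \<kappa>_le(2) by (simp add: distrib_left)
      qed
      ultimately show ?thesis unfolding \<Phi>_def J_def by linarith
    qed
    ultimately show ?thesis using J(1) g unfolding m_def e_def by linarith
  qed
  have yx: "norm (y - x) = \<rho>" by (simp add: \<rho>_def norm_minus_commute)
  have "(LINT z|lborel. d1 z / norm z ^ (CARD('n) + 1)) + (LINT z|lborel. d2 z / norm z ^ (CARD('n) + 1))
    \<le> (8 * \<beta> * X * ?G + 2 * \<kappa> * ?G) + 8 * \<beta> * X * ?G - unit_ball_vol (real CARD('n)) / 8 ^ CARD('n) * (m / \<rho>)"
    using coupling_gain[OF I1(1) I2(1) Hi d1_le d2_le H_nonneg(2) H_nonneg(1) _ m0 coupled]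
    unfolding has_bochner_integral_integral_eq[OF h1] has_bochner_integral_integral_eq[OF h2] yx
    using \<rho> by blast
  also have "unit_ball_vol (real CARD('n)) / 8 ^ CARD('n) * (m / \<rho>) = \<gamma> * X"
    by (simp add: \<gamma>_def m_def X\<rho>[symmetric])
  finally have sum: "lam * ((LINT z|lborel. d1 z / norm z ^ (CARD('n) + 1)) + (LINT z|lborel. d2 z / norm z ^ (CARD('n) + 1)))
     \<le> lam * (16 * \<beta> * X * ?G + 2 * \<kappa> * ?G - \<gamma> * X)"
    using par by (intro mult_left_mono) (auto simp: mult_ac)
  \<comment> \<open>The gain carries the factor lam; the majorants carry lam from the linear part
    and Lam - lam from the rest, in total Lam.\<close>
  have "c1 + c2 - A * (norm b1 + norm b2) \<le> 1 / 2 * (Lam * (16 * \<beta> * X * ?G + 2 * \<kappa> * ?G) - lam * \<gamma> * X)"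
    using ineq1 ineq2 I1(2) I2(2) sum
    unfolding has_bochner_integral_integral_eq[OF h1] has_bochner_integral_integral_eq[OF h2]
    by (simp add: algebra_simps)
  moreover have "A * (norm b1 + norm b2) \<le> A * (4 * \<beta> * X + \<kappa> / 2)"
    using norm_b1 norm_b2 par by (intro mult_left_mono) auto
  moreover have "- (5 * N / T) \<le> c1 + c2"
  proof -
    have "c1 + c2 = - (2 * r / \<epsilon>) - 4 * (N / T)"
      by (simp add: c1_def c2_def diff_divide_distrib)
    then show ?thesis using r(4) by simp
  qed
  moreover have "(\<beta> * (4 * A + 8 * Lam * ?G)) * X \<le> (lam * \<gamma> / 4) * X"
    using \<beta> X by (intro mult_right_mono) auto
  moreover have "0 \<le> \<kappa> * A" using \<kappa> par by simp
  ultimately have "lam * \<gamma> / 4 * X \<le> 6 * (N / T)"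
    using \<kappa>_le(3) by (simp add: algebra_simps)
  moreover have "lam * \<gamma> / 4 * (C * N / T) \<le> lam * \<gamma> / 4 * X"
    using X_ge par \<gamma> by (intro mult_left_mono) auto
  moreover have "lam * \<gamma> / 4 * (C * N / T) = (25 / 4 + 3 / 4 * (lam * \<gamma>)) * (N / T)"
  proof -
    have "lam * \<gamma> / 4 * C = 25 / 4 + 3 / 4 * (lam * \<gamma>)"
      using par \<gamma> unfolding C by (simp add: distrib_left)
    then show ?thesis by (metis mult.assoc times_divide_eq_right)
  qed
  moreover have "25 / 4 * (N / T) \<le> (25 / 4 + 3 / 4 * (lam * \<gamma>)) * (N / T)"
    using par \<gamma> N T by (intro mult_right_mono) auto
  moreover have "0 < N / T" using N T by simp
  ultimately show False by linarith
qed

lemma quad_test_ineq_mono: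
  assumes "quad_test_ineq A lam Lam T u" "T' \<le> T"
  shows "quad_test_ineq A lam Lam T' u"
  using assms unfolding quad_test_ineq_def by (meson order_trans)

subsection \<open>The Hoelder estimate\<close>

text \<open>Comparison from time 0 with a barrier centred at the given x, whose excess over m at (x,
  t) is \<kappa> (1 + K t) with \<kappa> arbitrarily small.\<close>

lemma max_principle:
  fixes u :: "(real^'n) \<times> real \<Rightarrow> real"
  assumes par: "0 \<le> A" "0 < lam" "lam \<le> Lam"
    and touch: "quad_test_ineq A lam Lam T u"
    and cont: "continuous_on (UNIV \<times> {0..T}) u"
    and bdd: "bounded (u ` (UNIV \<times> {0..T}))"
    and init: "\<And>x. u (x, 0) \<le> m"
    and t: "0 \<le> t" "t \<le> T"
  shows "u (x, t) \<le> m"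
proof (rule field_le_epsilon)
  fix e :: real assume e: "0 < e"
  obtain N where N: "\<And>x t. t \<in> {0..T} \<Longrightarrow> \<bar>u (x, t)\<bar> \<le> N"
    using bdd by (force simp: bounded_iff)
  define K where "K = A + Lam * qgrowth_mass TYPE('n) + 1"
  have K: "0 \<le> K" using par qgrowth_mass_nonneg[where 'n = 'n] by (simp add: K_def)
  obtain \<kappa> where \<kappa>: "0 < \<kappa>" "\<kappa> * (1 + K * t) \<le> e"
    using exists_small_multiplier[OF e, of "1 + K * t"] K t by auto
  have "u (x, t) \<le> m + \<kappa> * soft_power (1 / 4) 1 (x - x) + K * (\<kappa> * 1 powr (2 * (1 / 4) - 1)) * (t - 0)"
    unfolding K_def
  proof (rule barrier_comparison[OF par touch cont N])
    show "u (z, 0) \<le> m + \<kappa> * soft_power (1 / 4) 1 (z - x)" for z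
    proof -
      have "0 \<le> \<kappa> * soft_power (1 / 4) 1 (z - x)" using \<kappa> by simp
      then show ?thesis using init[of z] by linarith
    qed
  qed (use t \<kappa> in auto)
  also have "\<dots> = m + \<kappa> * (1 + K * t)" by (simp add: soft_power_at_0 algebra_simps)
  finally show "u (x, t) \<le> m + e" using \<kappa> by simp
qed

text \<open>The set where |f| exceeds the norm is null, and open by continuity, hence empty.\<close>

lemma continuous_abs_le_Linf_norm:
  fixes f :: "real^'n \<Rightarrow> real"
  assumes f: "continuous_on UNIV f" and bdd: "\<And>x. \<bar>f x\<bar> \<le> B"
  shows "\<bar>f x\<bar> \<le> Linf_norm f"
proof -
  let ?g = "\<lambda>x. ereal \<bar>f x\<bar>"
  have [measurable]: "f \<in> borel_measurable borel" using f by (rule borel_measurable_continuous_onI)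
  have le: "esssup lborel ?g \<le> ereal B" by (rule esssup_I) (use bdd in auto)
  have ae: "AE x in lborel. ?g x \<le> esssup lborel ?g" by (rule esssup_AE)
  \<comment> \<open>\<open>real_of_ereal\<close> is faithful only at finite values, so the essential
    supremum is bounded on both sides first.\<close>
  have "0 \<le> esssup lborel ?g"
  proof (rule ccontr)
    assume "\<not> ?thesis"
    with ae have "AE x::real^'n in lborel. False"
      by (auto elim!: eventually_mono) (meson abs_ge_zero ereal_less_eq(5) order_trans)
    then show False by (simp add: ae_filter_eq_bot_iff)
  qed
  with le have fin: "esssup lborel ?g = ereal (Linf_norm f)"
    unfolding Linf_norm_def by (cases "esssup lborel ?g") auto
  have ae': "AE x in lborel. \<bar>f x\<bar> \<le> Linf_norm f" using ae by (simp add: fin)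
  have "open {x. Linf_norm f < \<bar>f x\<bar>}"
    by (intro open_Collect_less continuous_intros f)
  moreover have "{x. Linf_norm f < \<bar>f x\<bar>} \<in> null_sets lborel"
    using ae' by (subst AE_iff_null_sets) (auto simp: not_less)
  then have "negligible {x. Linf_norm f < \<bar>f x\<bar>}"
    by (simp add: negligible_iff_null_sets null_sets_completionI)
  ultimately have "{x. Linf_norm f < \<bar>f x\<bar>} = {}"
    using open_not_negligible by blast
  then show ?thesis by (auto simp: not_less)
qed

text \<open>Regularity in time follows from that in space: at time s the modulus around x lies below
  a barrier, which then bounds the change at x up to time t, for u and for -u. In D, the factor K +
  1 = A + Lam G + 2 (G the kernel mass) stems from the barrier and 2 from s \<ge> T/2.\<close>

lemma space_time_holder_estimate:
  fixes u :: "(real^'n) \<times> real \<Rightarrow> real"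
  defines "\<gamma> \<equiv> unit_ball_vol (real CARD('n)) / (2 * 8 ^ CARD('n))"
  assumes par: "0 \<le> A" "0 < lam" "lam \<le> Lam"
    and \<beta>: "0 < \<beta>" "\<beta> \<le> 1 / 4" "\<beta> * (4 * A + 8 * Lam * qgrowth_mass TYPE('n)) \<le> lam * \<gamma> / 4"
    and C: "C = 25 / (lam * \<gamma>) + 3"
    and D: "D = 2 * C * (A + Lam * qgrowth_mass TYPE('n) + 2)"
    and touch: "quad_test_ineq A lam Lam T u" "quad_test_ineq A lam Lam T (\<lambda>p. - u p)"
    and cont: "continuous_on (UNIV \<times> {0..T}) u"
    and bdd: "\<And>x t. t \<in> {0..T} \<Longrightarrow> \<bar>u (x, t)\<bar> \<le> N"
    and T: "0 < T" and N: "0 < N" and s: "T / 2 \<le> s" "s \<le> t" and t: "t \<le> T"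
  shows "\<bar>u (x, t) - u (y, s)\<bar> \<le> D * N / T powr (2 * \<beta>) * (norm (x - y) powr (2 * \<beta>) + \<bar>t - s\<bar> powr (2 * \<beta>))"
proof -
  define K where "K = A + Lam * qgrowth_mass TYPE('n) + 1"
  have K: "1 \<le> K" using par qgrowth_mass_nonneg[where 'n = 'n] by (simp add: K_def)
  have \<gamma>: "0 < \<gamma>" by (simp add: \<gamma>_def)
  have C3: "3 < C" using par \<gamma> by (simp add: C)
  have s0: "0 < s" using s T by linarith
  define L where "L = C * N / s powr (2 * \<beta>)"
  have L: "0 < L" using C3 N s0 by (simp add: L_def)
  \<comment> \<open>The spatial estimate speaks of the final time, so it is applied on
    [0, s].\<close>
  have cont_s: "continuous_on (UNIV \<times> {0..s}) u"
    using s t by (intro continuous_on_subset[OF cont]) auto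
  have space: "u (p, s) - u (q, s) \<le> L * norm (p - q) powr (2 * \<beta>)" for p q
    unfolding L_def
    by (rule spatial_holder_estimate[OF par \<beta>[unfolded \<gamma>_def] C[unfolded \<gamma>_def] quad_test_ineq_mono[OF touch(1)] quad_test_ineq_mono[OF touch(2)] cont_s])
       (use s t s0 N bdd in auto)
  have space_abs: "\<bar>u (p, s) - u (q, s)\<bar> \<le> L * norm (p - q) powr (2 * \<beta>)" for p q
    using space[of p q] space[of q p] by (simp add: norm_minus_commute)
  have time: "\<bar>u (x, t) - u (x, s)\<bar> \<le> (K + 1) * L * \<bar>t - s\<bar> powr (2 * \<beta>)"
  proof (cases "s = t")
    case False
    \<comment> \<open>This choice balances the smoothing error L \<eta>^(2\<beta>) and the growth K
      L \<eta>^(2\<beta> - 1) (t - s).\<close>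
    define \<eta> where "\<eta> = t - s"
    have \<eta>: "0 < \<eta>" using False s by (simp add: \<eta>_def)
    have "L * norm (p - x) powr (2 * \<beta>) \<le> L * soft_power \<beta> \<eta> (p - x)" for p
      using L \<beta> soft_power_mono[of \<beta> 0 \<eta> "p - x"] by (intro mult_left_mono) (auto simp: soft_power_0)
    then have init: "u (p, s) \<le> u (x, s) + L * soft_power \<beta> \<eta> (p - x)" "- u (p, s) \<le> - u (x, s) + L * soft_power \<beta> \<eta> (p - x)" for p
      using space_abs[of p x] by (smt (verit))+
    have eq: "L * soft_power \<beta> \<eta> (x - x) + K * (L * \<eta> powr (2 * \<beta> - 1)) * (t - s) = (K + 1) * L * \<eta> powr (2 * \<beta>)"
      using \<eta> by (simp add: soft_power_at_0 powr_diff \<eta>_def[symmetric] algebra_simps)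
    have "u (x, t) \<le> u (x, s) + L * soft_power \<beta> \<eta> (x - x) + K * (L * \<eta> powr (2 * \<beta> - 1)) * (t - s)"
      unfolding K_def
      by (rule barrier_comparison[OF par touch(1) cont bdd \<beta>(1,2) \<eta> L _ init(1)]) (use s s0 t in auto)
    moreover have "- u (x, t) \<le> - u (x, s) + L * soft_power \<beta> \<eta> (x - x) + K * (L * \<eta> powr (2 * \<beta> - 1)) * (t - s)"
      unfolding K_def
      by (rule barrier_comparison[OF par touch(2) continuous_on_minus[OF cont] _ \<beta>(1,2) \<eta> L _ init(2)]) (use s s0 t bdd in auto)
    moreover have "\<bar>t - s\<bar> = \<eta>" using \<eta> by (simp add: \<eta>_def)
    ultimately show ?thesis using eq by (simp add: abs_le_iff)
  qed simp
  have L_le: "L \<le> 2 * C * N / T powr (2 * \<beta>)"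
  proof -
    have "(T / 2) powr (2 * \<beta>) \<le> s powr (2 * \<beta>)" using s T \<beta> by (intro powr_mono2) auto
    then have "L \<le> C * N / (T / 2) powr (2 * \<beta>)"
      unfolding L_def using C3 N T s0 by (intro divide_left_mono) auto
    also have "\<dots> = 2 powr (2 * \<beta>) * (C * N / T powr (2 * \<beta>))" using T by (simp add: powr_divide)
    also have "\<dots> \<le> 2 powr 1 * (C * N / T powr (2 * \<beta>))"
      using \<beta> C3 N by (intro mult_right_mono powr_mono) auto
    finally show ?thesis by simp
  qed
  have "\<bar>u (x, t) - u (y, s)\<bar> \<le> (K + 1) * L * \<bar>t - s\<bar> powr (2 * \<beta>) + L * norm (x - y) powr (2 * \<beta>)"
    using time space_abs[of x y] by linarith
  also have "\<dots> \<le> (K + 1) * L * \<bar>t - s\<bar> powr (2 * \<beta>) + (K + 1) * L * norm (x - y) powr (2 * \<beta>)"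
    using K L by (intro add_left_mono mult_right_mono) auto
  also have "\<dots> = (K + 1) * L * (norm (x - y) powr (2 * \<beta>) + \<bar>t - s\<bar> powr (2 * \<beta>))"
    by (simp add: algebra_simps)
  also have "\<dots> \<le> (K + 1) * (2 * C * N / T powr (2 * \<beta>)) * (norm (x - y) powr (2 * \<beta>) + \<bar>t - s\<bar> powr (2 * \<beta>))"
    using K L_le by (intro mult_right_mono mult_left_mono) auto
  also have "(K + 1) * (2 * C * N / T powr (2 * \<beta>)) = D * N / T powr (2 * \<beta>)"
    by (simp add: D K_def algebra_simps)
  finally show ?thesis .
qed

theorem theorem6p1:
  fixes A lam Lam :: real
  assumes "0 \<le> A" and "0 < lam" and "lam \<le> Lam"
  shows "\<exists>\<alpha> C C'. 0 < \<alpha> \<and> 0 < C \<and> 0 < C' \<and>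
    (\<forall>t. \<forall>u :: (real^'n) \<times> real \<Rightarrow> real.
       0 < t \<and>
       bounded (u ` (UNIV \<times> {0..t})) \<and>
       continuous_on (UNIV \<times> {0..t}) u \<and>
       viscosity_sub A lam Lam t u \<and>
       viscosity_super A lam Lam t u \<longrightarrow>
       (\<forall>x y s. 0 \<le> s \<and> s \<le> t \<longrightarrow>
          \<bar>u (x, t) - u (y, s)\<bar> \<le> C * Linf_norm (\<lambda>z. u (z, 0))
             * ((norm (x - y) powr \<alpha> + \<bar>t - s\<bar> powr \<alpha>) / t powr \<alpha>)) \<and>
       holder_seminorm \<alpha> (UNIV \<times> {t/2..t}) u
         \<le> ereal (C' / t powr \<alpha> * Linf_norm (\<lambda>z. u (z, 0))))"
proof -
  define \<gamma> where "\<gamma> = unit_ball_vol (real CARD('n)) / (2 * 8 ^ CARD('n))"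
  define C where "C = 25 / (lam * \<gamma>) + 3"
  define D where "D = 2 * C * (A + Lam * qgrowth_mass TYPE('n) + 2)"
  have G: "0 \<le> Lam * qgrowth_mass TYPE('n)" using assms qgrowth_mass_nonneg[where 'n = 'n] by simp
  have \<gamma>: "0 < \<gamma>" by (simp add: \<gamma>_def)
  have C3: "3 < C" using assms \<gamma> by (simp add: C_def)
  \<comment> \<open>D \<ge> 4 lets the trivial bound by twice the initial norm settle the times s <
    T/2.\<close>
  have "2 * C * 2 \<le> D" unfolding D_def using C3 G assms by (intro mult_left_mono) auto
  then have D: "4 \<le> D" using C3 by linarith
  obtain \<beta>' where \<beta>': "0 < \<beta>'" "\<beta>' * (4 * A + 8 * Lam * qgrowth_mass TYPE('n)) \<le> lam * \<gamma> / 4"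
    using exists_small_multiplier[of "lam * \<gamma> / 4" "4 * A + 8 * Lam * qgrowth_mass TYPE('n)"] assms \<gamma> G by auto
  define \<beta> where "\<beta> = min \<beta>' (1 / 4)"
  have "\<beta> * (4 * A + 8 * Lam * qgrowth_mass TYPE('n)) \<le> \<beta>' * (4 * A + 8 * Lam * qgrowth_mass TYPE('n))"
    using assms G by (intro mult_right_mono) (auto simp: \<beta>_def)
  with \<beta>' have \<beta>: "0 < \<beta>" "\<beta> \<le> 1 / 4" "\<beta> * (4 * A + 8 * Lam * qgrowth_mass TYPE('n)) \<le> lam * \<gamma> / 4"
    by (auto simp: \<beta>_def)
  have main: "(\<forall>x y s. 0 \<le> s \<and> s \<le> T \<longrightarrow>
          \<bar>u (x, T) - u (y, s)\<bar> \<le> D * Linf_norm (\<lambda>z. u (z, 0))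
             * ((norm (x - y) powr (2 * \<beta>) + \<bar>T - s\<bar> powr (2 * \<beta>)) / T powr (2 * \<beta>))) \<and>
       holder_seminorm (2 * \<beta>) (UNIV \<times> {T/2..T}) u
         \<le> ereal (D / T powr (2 * \<beta>) * Linf_norm (\<lambda>z. u (z, 0)))"
    if T: "0 < T" and bdd: "bounded (u ` (UNIV \<times> {0..T}))" and cont: "continuous_on (UNIV \<times> {0..T}) u"
      and sub: "viscosity_sub A lam Lam T u" and super: "viscosity_super A lam Lam T u"
    for T and u :: "(real^'n) \<times> real \<Rightarrow> real"
  proof -
    let ?N = "Linf_norm (\<lambda>z. u (z, 0))"
    note touch = viscosity_sub_imp_quad_test_ineq[OF sub order_refl] viscosity_super_imp_quad_test_ineq[OF super order_refl]
    obtain B where B: "\<And>x t. t \<in> {0..T} \<Longrightarrow> \<bar>u (x, t)\<bar> \<le> B"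
      using bdd by (force simp: bounded_iff)
    have init: "\<bar>u (x, 0)\<bar> \<le> ?N" for x
      using T B by (intro continuous_abs_le_Linf_norm[where f = "\<lambda>z. u (z, 0)" and B = B] continuous_on_compose2[OF cont] continuous_intros) auto
    have init': "u (x, 0) \<le> ?N" "- u (x, 0) \<le> ?N" for x
      using init[of x] by (simp_all only: abs_le_iff)
    have N: "\<bar>u (x, t)\<bar> \<le> ?N" if "t \<in> {0..T}" for x t
    proof -
      have "u (x, t) \<le> ?N"
        using that by (intro max_principle[OF assms touch(1) cont bdd init'(1)]) auto
      moreover have *: "bounded ((\<lambda>p. - u p) ` (UNIV \<times> {0..T}))" using bdd by (auto simp: bounded_iff)
      have "- u (x, t) \<le> ?N"
        using that by (intro max_principle[OF assms touch(2) continuous_on_minus[OF cont] * init'(2)]) auto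
      ultimately show ?thesis by (simp only: abs_le_iff)
    qed
    have N0: "0 \<le> ?N" using init[of 0] by linarith
    have core': "\<bar>u (x, t) - u (y, s)\<bar> \<le> D * ?N / T powr (2 * \<beta>) * (norm (x - y) powr (2 * \<beta>) + \<bar>t - s\<bar> powr (2 * \<beta>))"
      if st: "T / 2 \<le> s" "s \<le> t" "t \<le> T" for x y s t
    \<comment> \<open>The estimates assume a positive bound; if the initial norm is 0, then u
      vanishes by the maximum principle.\<close>
    proof (cases "?N = 0")
      case True
      then show ?thesis using N[of t x] N[of s y] st T by simp
    next
      case False
      show ?thesis
        by (rule space_time_holder_estimate[OF assms \<beta>[unfolded \<gamma>_def] C_def[unfolded \<gamma>_def] D_def touch cont N T _ st])
           (use False N0 in auto)
    qed
    have core: "\<bar>u (x, t) - u (y, s)\<bar> \<le> D * ?N / T powr (2 * \<beta>) * (norm (x - y) powr (2 * \<beta>) + \<bar>t - s\<bar> powr (2 * \<beta>))"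
      if "t \<in> {T/2..T}" "s \<in> {T/2..T}" for x y s t
    proof (cases "s \<le> t")
      case True then show ?thesis using that by (intro core') auto
    next
      case False
      then show ?thesis using core'[of t s y x] that by (simp add: abs_minus_commute norm_minus_commute)
    qed
    have "\<bar>u (x, T) - u (y, s)\<bar> \<le> D * ?N
             * ((norm (x - y) powr (2 * \<beta>) + \<bar>T - s\<bar> powr (2 * \<beta>)) / T powr (2 * \<beta>))"
      if "0 \<le> s" "s \<le> T" for x y s
    proof (cases "T / 2 \<le> s")
      case True
      then show ?thesis using core[of T s x y] that T by (simp add: mult_ac)
    next
      case False
      \<comment> \<open>Here |T - s| / T > 1/2 and 2\<beta> \<le> 1, so the scaled modulus is at
        least 1/2.\<close>
      have "1 / 2 \<le> (1 / 2) powr (2 * \<beta>)"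
        using \<beta> powr_mono'[of "2 * \<beta>" 1 "1 / 2 :: real"] by simp
      also have "\<dots> \<le> (\<bar>T - s\<bar> / T) powr (2 * \<beta>)"
        using False T \<beta> by (intro powr_mono2) (auto simp: field_simps)
      also have "\<dots> = \<bar>T - s\<bar> powr (2 * \<beta>) / T powr (2 * \<beta>)" using T by (simp add: powr_divide)
      also have "\<dots> \<le> (norm (x - y) powr (2 * \<beta>) + \<bar>T - s\<bar> powr (2 * \<beta>)) / T powr (2 * \<beta>)"
        by (intro divide_right_mono) auto
      finally have "(4 * ?N) * (1 / 2) \<le> (D * ?N) * ((norm (x - y) powr (2 * \<beta>) + \<bar>T - s\<bar> powr (2 * \<beta>)) / T powr (2 * \<beta>))"
        using D N0 by (intro mult_mono) auto
      moreover have "\<bar>u (x, T) - u (y, s)\<bar> \<le> 2 * ?N"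
        using N[of T x] N[of s y] that T by auto
      ultimately show ?thesis by linarith
    qed
    moreover have "holder_seminorm (2 * \<beta>) (UNIV \<times> {T/2..T}) u \<le> ereal (D / T powr (2 * \<beta>) * ?N)"
      unfolding holder_seminorm_def
    proof (rule SUP_least)
      fix pq assume pq: "pq \<in> {(p, q). p \<in> (UNIV :: (real^'n) set) \<times> {T/2..T} \<and> q \<in> UNIV \<times> {T/2..T} \<and> p \<noteq> q}"
      obtain x t y s where eq: "pq = ((x, t), (y, s))" by (metis surj_pair)
      have *: "t \<in> {T/2..T}" "s \<in> {T/2..T}" "(x, t) \<noteq> (y, s)" using pq by (auto simp: eq)
      have "0 < norm (x - y) powr (2 * \<beta>) + \<bar>t - s\<bar> powr (2 * \<beta>)"
        using *(3) by (cases "x = y") (auto intro!: add_pos_nonneg)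
      then show "(\<lambda>((x, t), (y, s)).
            ereal (\<bar>u (x, t) - u (y, s)\<bar> / (norm (x - y) powr (2 * \<beta>) + \<bar>t - s\<bar> powr (2 * \<beta>)))) pq
          \<le> ereal (D / T powr (2 * \<beta>) * ?N)"
        using core[OF *(1,2), of x y] by (simp add: eq divide_le_eq)
    qed
    ultimately show ?thesis by blast
  qed
  show ?thesis
    \<comment> \<open>The same D serves as both constants.\<close>
    using \<beta>(1) D main by (intro exI[of _ "2 * \<beta>"] exI[of _ D]) auto
qed

end
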